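(* Suppose $0<p_0,p_1<1$, with $p_1$ and $p_0$ both bounded away from $0$ and $1$. Let $\log(\mathrm{COR})=\mathrm{logit}(p_1)-\mathrm{logit}(p_0)$ and $\log(\widehat{\mathrm{COR}})=\mathrm{logit}(\widehat p_1)-\mathrm{logit}(\widehat p_0)$, where $\mathrm{logit}(x)=\log(x)-\log(1-x)$. As $N\to\infty$, $\log(\widehat{\mathrm{COR}})$ is consistent for $\log(\mathrm{COR})$ and asymptotically Normal with asymptotic variance $$\frac{N_1p_1(1-p_1)+N_0p_0(1-p_0)}{N\,p_1(1-p_1)p_0(1-p_0)}\left\{\frac{S_1^2}{N_1p_1(1-p_1)}+\frac{S_0^2}{N_0p_0(1-p_0)}-\frac{S_\tau^2}{N_1p_1(1-p_1)+N_0p_0(1-p_0)}\right\}.$$ Assuming $S_\tau^2=0$, as in Neyman (1923), the asymptotic variance can be estimated by $$\widehat V_{\mathrm{COR}}=\frac1{n_{11}}+\frac1{n_{10}}+\frac1{n_{01}}+\frac1{n_{00}}.$$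
   Context: There are $N$ units with fixed (non-random) binary potential outcomes $(Y_i(1),Y_i(0))\in\{0,1\}^2$ under treatment and control, $i=1,\dots,N$. For $t=0,1$: $p_t=\frac1N\sum_{i=1}^NY_i(t)$ and $S_t^2=\frac1{N-1}\sum_{i=1}^N\{Y_i(t)-p_t\}^2$. Also $\tau_i=Y_i(1)-Y_i(0)$, $\tau=\frac1N\sum_{i=1}^N\tau_i=p_1-p_0$, and $S_\tau^2=\frac1{N-1}\sum_{i=1}^N(\tau_i-\tau)^2$. COR stands for the causal odds ratio. In a completely randomized experiment, $\boldsymbol W=(W_1,\dots,W_N)\in\{0,1\}^N$ is uniformly distributed over vectors with exactly $N_1$ ones ($N_1$ fixed, $N_0=N-N_1$); this is the only source of randomness. Observed outcomes are $Y_i^{\mathrm{obs}}=W_iY_i(1)+(1-W_i)Y_i(0)$. Counts: $n_{11}$ = number of $i$ with $W_i=1,Y_i^{\mathrm{obs}}=1$; $n_{10}$ = number with $W_i=1,Y_i^{\mathrm{obs}}=0$; $n_{01}$ = number with $W_i=0,Y_i^{\mathrm{obs}}=1$; $n_{00}$ = number with $W_i=0,Y_i^{\mathrm{obs}}=0$. Put $\widehat p_1=n_{11}/N_1$ and $\widehat p_0=n_{01}/N_0$.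
   Formalization: Both N_1 and N_0 are assumed to tend to infinity (otherwise consistency fails), and asymptotic Normality is claimed only if min(N_1,N_0)^2 times the asymptotic variance tends to infinity (for Y_i(0)=1-Y_i(1), N_1=N_0 that variance is 0). *)

theory Defs
  imports "HOL-Probability.Probability"
begin

text \<open>
  Potential outcomes of a population of \<open>N\<close> units are a function \<open>Y\<close>, where \<open>Y t i\<close> is the
  outcome of unit \<open>i \<in> {1..N}\<close> under arm \<open>t\<close> (1 = treatment, 0 = control).
\<close>

definition p_of :: "nat \<Rightarrow> (nat \<Rightarrow> nat \<Rightarrow> real) \<Rightarrow> nat \<Rightarrow> real" where
  "p_of N Y t = (\<Sum>i=1..N. Y t i) / real N"

definition S2 :: "nat \<Rightarrow> (nat \<Rightarrow> nat \<Rightarrow> real) \<Rightarrow> nat \<Rightarrow> real" where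
  "S2 N Y t = (\<Sum>i=1..N. (Y t i - p_of N Y t)\<^sup>2) / (real N - 1)"

definition tau_unit :: "(nat \<Rightarrow> nat \<Rightarrow> real) \<Rightarrow> nat \<Rightarrow> real" where
  "tau_unit Y i = Y 1 i - Y 0 i"

definition tau :: "nat \<Rightarrow> (nat \<Rightarrow> nat \<Rightarrow> real) \<Rightarrow> real" where
  "tau N Y = (\<Sum>i=1..N. tau_unit Y i) / real N"

definition S2_tau :: "nat \<Rightarrow> (nat \<Rightarrow> nat \<Rightarrow> real) \<Rightarrow> real" where
  "S2_tau N Y = (\<Sum>i=1..N. (tau_unit Y i - tau N Y)\<^sup>2) / (real N - 1)"

definition assignments :: "nat \<Rightarrow> nat \<Rightarrow> (nat \<Rightarrow> real) set" where
  "assignments N N1 = {W \<in> {1..N} \<rightarrow>\<^sub>E {0, 1}. card {i \<in> {1..N}. W i = 1} = N1}"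

definition randomization :: "nat \<Rightarrow> nat \<Rightarrow> (nat \<Rightarrow> real) pmf" where
  "randomization N N1 = pmf_of_set (assignments N N1)"

definition Y_obs :: "(nat \<Rightarrow> nat \<Rightarrow> real) \<Rightarrow> (nat \<Rightarrow> real) \<Rightarrow> nat \<Rightarrow> real" where
  "Y_obs Y W i = W i * Y 1 i + (1 - W i) * Y 0 i"

definition n_obs :: "nat \<Rightarrow> (nat \<Rightarrow> nat \<Rightarrow> real) \<Rightarrow> (nat \<Rightarrow> real) \<Rightarrow> real \<Rightarrow> real \<Rightarrow> nat" where
  "n_obs N Y W w y = card {i \<in> {1..N}. W i = w \<and> Y_obs Y W i = y}"

definition p_hat1 :: "nat \<Rightarrow> nat \<Rightarrow> (nat \<Rightarrow> nat \<Rightarrow> real) \<Rightarrow> (nat \<Rightarrow> real) \<Rightarrow> real" where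
  "p_hat1 N N1 Y W = real (n_obs N Y W 1 1) / real N1"

definition p_hat0 :: "nat \<Rightarrow> nat \<Rightarrow> (nat \<Rightarrow> nat \<Rightarrow> real) \<Rightarrow> (nat \<Rightarrow> real) \<Rightarrow> real" where
  "p_hat0 N N1 Y W = real (n_obs N Y W 0 1) / real (N - N1)"

text \<open>
  When some observed count is zero, the conventions \<open>ln 0 = 0\<close> and \<open>1 / 0 = 0\<close> give the estimators
  below an arbitrary finite value. They do not affect limits in probability or in distribution
  in regimes where the probability of a zero count vanishes.
\<close>

definition logit :: "real \<Rightarrow> real" where
  "logit x = ln x - ln (1 - x)"

definition log_COR :: "nat \<Rightarrow> (nat \<Rightarrow> nat \<Rightarrow> real) \<Rightarrow> real" where
  "log_COR N Y = logit (p_of N Y 1) - logit (p_of N Y 0)"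

definition log_COR_hat :: "nat \<Rightarrow> nat \<Rightarrow> (nat \<Rightarrow> nat \<Rightarrow> real) \<Rightarrow> (nat \<Rightarrow> real) \<Rightarrow> real" where
  "log_COR_hat N N1 Y W = logit (p_hat1 N N1 Y W) - logit (p_hat0 N N1 Y W)"

definition avar_log_COR :: "nat \<Rightarrow> nat \<Rightarrow> (nat \<Rightarrow> nat \<Rightarrow> real) \<Rightarrow> real" where
  "avar_log_COR N N1 Y =
    (let p1 = p_of N Y 1; p0 = p_of N Y 0; m1 = real N1; m0 = real (N - N1) in
      (m1 * p1 * (1 - p1) + m0 * p0 * (1 - p0)) / (real N * p1 * (1 - p1) * p0 * (1 - p0)) *
      (S2 N Y 1 / (m1 * p1 * (1 - p1)) + S2 N Y 0 / (m0 * p0 * (1 - p0))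
        - S2_tau N Y / (m1 * p1 * (1 - p1) + m0 * p0 * (1 - p0))))"

definition V_hat_COR :: "nat \<Rightarrow> (nat \<Rightarrow> nat \<Rightarrow> real) \<Rightarrow> (nat \<Rightarrow> real) \<Rightarrow> real" where
  "V_hat_COR N Y W =
    1 / real (n_obs N Y W 1 1) + 1 / real (n_obs N Y W 1 0) +
    1 / real (n_obs N Y W 0 1) + 1 / real (n_obs N Y W 0 0)"

text \<open>Convergence in probability to a constant, where the \<open>k\<close>-th variable \<open>X k\<close> has its own
  probability space \<open>P k\<close>.\<close>

definition tendsto_in_prob :: "(nat \<Rightarrow> 'a pmf) \<Rightarrow> (nat \<Rightarrow> 'a \<Rightarrow> real) \<Rightarrow> real \<Rightarrow> bool" where
  "tendsto_in_prob P X c \<longleftrightarrow>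
    (\<forall>\<epsilon>>0. (\<lambda>k. measure_pmf.prob (P k) {\<omega>. \<bar>X k \<omega> - c\<bar> > \<epsilon>}) \<longlonglongrightarrow> 0)"

end

theory Submission
  imports Defs
begin

text \<open>
  Under complete randomization the treated group is a simple random sample \<open>A\<close> of \<open>N1\<close> out of \<open>N\<close>
  units. A Taylor expansion of the logit at the two true proportions gives
  \<open>log_COR_hat - log_COR = L + R\<close>, where the linear part \<open>L\<close> is the sum over \<open>i \<in> A\<close> of fixed
  numbers \<open>c i\<close> with total zero (\<open>linear_error_eq\<close>), and the remainder \<open>R\<close> is of the order of the squared
  errors of the two estimated proportions, hence of order \<open>1 / m\<close> with \<open>m = min N1 N0\<close>
  (\<open>log_error_linearization\<close>, \<open>E_sq_error_le\<close>). The variance of \<open>L\<close> is not merely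
  close to the claimed asymptotic variance \<open>\<sigma>\<^sup>2\<close> but equal to it, for every population
  whose two proportions are neither \<open>0\<close> nor \<open>1\<close> (\<open>E_sum_influence_square\<close>).

  Consistency and the variance estimator need only that the proportions are consistent in mean square.
  For normality, \<open>m\<^sup>2 * \<sigma>\<^sup>2 \<rightarrow> \<infinity>\<close> does two things at once: it makes \<open>R / \<sigma>\<close> negligible, and,
  since \<open>\<bar>c i\<bar>\<close> is of order \<open>1 / m\<close>, it makes each single summand of \<open>L / \<sigma>\<close> negligible, which is
  what a central limit theorem for sampling without replacement requires.

  That central limit theorem (\<open>char_sample_sum_bound\<close>) is proved by Stein's method. Exchanging a
  sampled unit \<open>i\<close> with an unsampled unit \<open>j\<close> is a bijection on the triples \<open>(A, i, j)\<close>. For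
  centred \<open>c\<close>, writing \<open>T\<close> for the sum of \<open>c\<close> over \<open>A\<close>, this symmetry gives the exact identity
  \<open>2 N E[T f(T)] = E[\<Sum>i\<in>A. \<Sum>j\<notin>A. d (f(T + d) - f(T))]\<close> with \<open>d = c j - c i\<close>
  (\<open>stein_identity\<close>). With \<open>f x = 1\<close> and \<open>f x = x\<close> it yields the mean and the variance of \<open>T\<close>. With
  \<open>f x = exp (\<i> t x)\<close> it says that the characteristic function \<open>\<phi>\<close> of a \<open>T\<close> of variance \<open>1\<close> solves
  \<open>\<phi>'(t) = - t \<phi>(t)\<close> up to an error controlled by the largest \<open>\<bar>c i\<bar>\<close> and by \<open>1 / N\<close>, so that \<open>\<phi>(t)\<close>
  is close to \<open>exp (- t\<^sup>2 / 2)\<close>. Levy's continuity theorem finishes the proof.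
\<close>

section \<open>Sums over a simple random sample\<close>

definition samples :: "'a set \<Rightarrow> nat \<Rightarrow> 'a set set" where
  "samples U n = {A. A \<subseteq> U \<and> card A = n}"

text \<open>
  Replacing each increment by its first-order term. It is stated for an abstract \<open>F\<close>, and applied below with
  \<open>F i j = f (x + d i j)\<close>, \<open>a = f x\<close> and \<open>z * a\<close> the derivative of \<open>f\<close> at \<open>x\<close>.
\<close>

lemma sum_taylor_remainder:
  fixes d :: "'i \<Rightarrow> 'j \<Rightarrow> real" and F :: "'i \<Rightarrow> 'j \<Rightarrow> complex" and a z :: complex
  shows "(\<Sum>i\<in>A. \<Sum>j\<in>B. d i j *\<^sub>R (F i j - a - z * (d i j *\<^sub>R a))) =
    (\<Sum>i\<in>A. \<Sum>j\<in>B. d i j *\<^sub>R (F i j - a)) - z * ((\<Sum>i\<in>A. \<Sum>j\<in>B. (d i j)\<^sup>2) *\<^sub>R a)"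
proof -
  have "d i j *\<^sub>R (F i j - a - z * (d i j *\<^sub>R a)) = d i j *\<^sub>R (F i j - a) - z * ((d i j)\<^sup>2 *\<^sub>R a)" for i j
    by (simp add: scaleR_diff_right power2_eq_square)
  then show ?thesis
    by (simp only: sum_subtractf sum_distrib_left[symmetric] scaleR_sum_left[symmetric])
qed

locale simple_random_sampling =
  fixes U :: "'a set" and n :: nat
  assumes finite_U: "finite U" and n_pos: "0 < n" and n_less: "n < card U"
begin

abbreviation P :: "'a set pmf" where
  "P \<equiv> pmf_of_set (samples U n)"

abbreviation E :: "('a set \<Rightarrow> 'b::{banach, second_countable_topology}) \<Rightarrow> 'b" where
  "E f \<equiv> measure_pmf.expectation P f"

lemma finite_samples: "finite (samples U n)"
  using finite_U by (simp add: samples_def)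

lemma samples_nonempty: "samples U n \<noteq> {}"
  using obtain_subset_with_card_n[of n U] n_less by (auto simp: samples_def)

lemma set_P: "set_pmf P = samples U n"
  using finite_samples samples_nonempty by simp

lemma integrable_P [simp]:
  fixes f :: "'a set \<Rightarrow> 'b::{banach, second_countable_topology}"
  shows "integrable (measure_pmf P) f"
  by (rule integrable_measure_pmf_finite) (simp add: set_P finite_samples)

lemma E_cong:
  fixes f g :: "'a set \<Rightarrow> 'b::{banach, second_countable_topology}"
  assumes "\<And>A. A \<in> samples U n \<Longrightarrow> f A = g A"
  shows "E f = E g"
  by (rule integral_cong_AE) (auto simp: AE_measure_pmf_iff set_P assms)

lemma E_mono:
  fixes f g :: "'a set \<Rightarrow> real"
  assumes "\<And>A. A \<in> samples U n \<Longrightarrow> f A \<le> g A"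
  shows "E f \<le> E g"
  by (rule integral_mono_AE) (auto simp: AE_measure_pmf_iff set_P assms)

lemma E_eq_sum:
  fixes f :: "'a set \<Rightarrow> 'b::{banach, second_countable_topology}"
  shows "E f = (\<Sum>A\<in>samples U n. f A) /\<^sub>R real (card (samples U n))"
  using finite_samples samples_nonempty
  by (subst integral_measure_pmf[of "samples U n"]) (auto simp: scaleR_sum_right divide_inverse)

lemma card_complement: "A \<in> samples U n \<Longrightarrow> card (U - A) = card U - n"
  using finite_U by (auto simp: samples_def card_Diff_subset finite_subset)

lemma finite_sample: "A \<in> samples U n \<Longrightarrow> finite A"
  using finite_U by (auto simp: samples_def finite_subset)

lemma sum_complement:
  fixes c :: "'a \<Rightarrow> real"
  assumes "A \<in> samples U n"
  shows "sum c (U - A) = sum c U - sum c A"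
  using assms finite_U by (auto simp: samples_def sum_diff)

text \<open>
  Exchanging \<open>i \<in> A\<close> with \<open>j \<notin> A\<close> is an involution on the triples \<open>(A, i, j)\<close> and the sample is uniform,
  so reindexing along it preserves the expectation. In Stein's terms, the sample and its swapped copy form an
  exchangeable pair.
\<close>

lemma E_swap:
  fixes g :: "'a set \<Rightarrow> 'a \<Rightarrow> 'a \<Rightarrow> 'b::{banach, second_countable_topology}"
  shows "E (\<lambda>A. \<Sum>i\<in>A. \<Sum>j\<in>U - A. g A i j) =
         E (\<lambda>A. \<Sum>i\<in>A. \<Sum>j\<in>U - A. g (insert j (A - {i})) j i)"
proof -
  define X where "X = Sigma (samples U n) (\<lambda>A. A \<times> (U - A))"
  define h where "h = (\<lambda>(A, i, j). (insert j (A - {i}), j, i :: 'a))"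
  have triple: "(\<Sum>A\<in>samples U n. \<Sum>i\<in>A. \<Sum>j\<in>U - A. k A i j) = (\<Sum>(A, i, j)\<in>X. k A i j)"
    for k :: "'a set \<Rightarrow> 'a \<Rightarrow> 'a \<Rightarrow> 'b"
    unfolding X_def using finite_samples finite_sample finite_U
    by (subst sum.Sigma[symmetric]) (auto intro!: sum.cong simp: sum.cartesian_product)
  have hX: "h x \<in> X" and hh: "h (h x) = x" if "x \<in> X" for x
  proof -
    obtain A i j where x: "x = (A, i, j)" by (cases x)
    with that have *: "A \<subseteq> U" "card A = n" "i \<in> A" "j \<in> U" "j \<notin> A"
      by (auto simp: X_def samples_def)
    have "finite A" using * finite_U finite_subset by blast
    then have "card (insert j (A - {i})) = n"
      using * n_pos by (simp add: card_Diff_singleton)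
    then show "h x \<in> X" using * by (auto simp: x X_def h_def samples_def)
    show "h (h x) = x" using * by (auto simp: x h_def)
  qed
  have "(\<Sum>(A, i, j)\<in>X. g A i j) = (\<Sum>(A, i, j)\<in>X. g (insert j (A - {i})) j i)"
    by (rule sum.reindex_bij_witness[where i = h and j = h])
       (auto simp: hX hh, auto simp: h_def X_def insert_absorb)
  then show ?thesis by (simp add: E_eq_sum triple)
qed

lemma sum_swap:
  fixes c :: "'a \<Rightarrow> real"
  assumes "A \<in> samples U n" "i \<in> A" "j \<in> U - A"
  shows "sum c (insert j (A - {i})) = sum c A + (c j - c i)"
  using assms finite_sample[OF assms(1)] by (simp add: sum_diff1)

text \<open>
  Averaged over all exchanges, the change of \<open>T = sum c A\<close> is a negative multiple of \<open>T\<close> itself: the regression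
  property on which the exchangeable pair method rests.
\<close>

lemma sum_pair_differences:
  fixes c :: "'a \<Rightarrow> real"
  assumes A: "A \<in> samples U n" and c: "sum c U = 0"
  shows "(\<Sum>i\<in>A. \<Sum>j\<in>U - A. c j - c i) = - real (card U) * sum c A"
proof -
  have "(\<Sum>i\<in>A. \<Sum>j\<in>U - A. c j - c i) =
        real (card A) * sum c (U - A) - real (card (U - A)) * sum c A"
    by (simp add: sum_subtractf sum_distrib_left)
  also have "\<dots> = - real (card U) * sum c A"
    using A c n_less by (simp add: sum_complement card_complement of_nat_diff algebra_simps)
      (simp add: samples_def algebra_simps)
  finally show ?thesis .
qed

text \<open>
  With \<open>d = c j - c i\<close>, the swap turns \<open>E[\<Sum>\<Sum> d f(T)]\<close> into \<open>- E[\<Sum>\<Sum> d f(T + d)]\<close>. Hence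
  \<open>E[\<Sum>\<Sum> d (f(T + d) - f(T))]\<close> is minus twice the former, which \<open>sum_pair_differences\<close> evaluates.
\<close>

theorem stein_identity:
  fixes c :: "'a \<Rightarrow> real" and f :: "real \<Rightarrow> 'b::{banach, second_countable_topology}"
  assumes c: "sum c U = 0"
  shows "(2 * real (card U)) *\<^sub>R E (\<lambda>A. sum c A *\<^sub>R f (sum c A)) =
    E (\<lambda>A. \<Sum>i\<in>A. \<Sum>j\<in>U - A. (c j - c i) *\<^sub>R (f (sum c A + (c j - c i)) - f (sum c A)))"
proof -
  define s where "s = E (\<lambda>A. \<Sum>i\<in>A. \<Sum>j\<in>U - A. (c j - c i) *\<^sub>R f (sum c A))"
  have s1: "s = - (real (card U) *\<^sub>R E (\<lambda>A. sum c A *\<^sub>R f (sum c A)))"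
  proof -
    have "s = E (\<lambda>A. (- real (card U)) *\<^sub>R (sum c A *\<^sub>R f (sum c A)))"
      unfolding s_def
    proof (rule E_cong)
      fix A assume A: "A \<in> samples U n"
      show "(\<Sum>i\<in>A. \<Sum>j\<in>U - A. (c j - c i) *\<^sub>R f (sum c A)) =
            (- real (card U)) *\<^sub>R (sum c A *\<^sub>R f (sum c A))"
        unfolding scaleR_sum_left[symmetric] sum_pair_differences[OF A c] by simp
    qed
    then show ?thesis by (simp only: integral_scaleR_right) simp
  qed
  have "s = E (\<lambda>A. \<Sum>i\<in>A. \<Sum>j\<in>U - A. (c i - c j) *\<^sub>R f (sum c (insert j (A - {i}))))"
    unfolding s_def by (rule E_swap)
  also have "\<dots> = E (\<lambda>A. - (\<Sum>i\<in>A. \<Sum>j\<in>U - A. (c j - c i) *\<^sub>R f (sum c A + (c j - c i))))"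
    unfolding sum_negf[symmetric]
    by (intro E_cong sum.cong refl) (simp only: sum_swap, simp add: algebra_simps)
  finally have s2: "E (\<lambda>A. \<Sum>i\<in>A. \<Sum>j\<in>U - A. (c j - c i) *\<^sub>R f (sum c A + (c j - c i))) = - s"
    by simp
  have "E (\<lambda>A. \<Sum>i\<in>A. \<Sum>j\<in>U - A. (c j - c i) *\<^sub>R (f (sum c A + (c j - c i)) - f (sum c A))) = - s - s"
    unfolding scaleR_diff_right sum_subtractf
    unfolding Bochner_Integration.integral_diff[OF integrable_P integrable_P]
    unfolding s_def[symmetric] s2 by (rule refl)
  also have "\<dots> = (2 * real (card U)) *\<^sub>R E (\<lambda>A. sum c A *\<^sub>R f (sum c A))"
    unfolding s1 mult_2 scaleR_left_distrib by (simp only: minus_minus diff_minus_eq_add)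
  finally show ?thesis by (rule sym)
qed

lemma E_sum:
  fixes c :: "'a \<Rightarrow> real"
  shows "E (sum c) = real n / real (card U) * sum c U"
proof -
  define b where "b = sum c U / real (card U)"
  have N: "card U > 0" using n_less by simp
  have "sum (\<lambda>i. c i - b) U = 0" using N by (simp add: sum_subtractf b_def)
  from stein_identity[OF this, of "\<lambda>_. 1::real"] have "E (\<lambda>A. sum (\<lambda>i. c i - b) A) = 0"
    using N by simp
  also have "E (\<lambda>A. sum (\<lambda>i. c i - b) A) = E (\<lambda>A. sum c A - real n * b)"
    by (rule E_cong) (simp add: sum_subtractf samples_def)
  finally show ?thesis by (simp add: b_def)
qed

lemma sum_pair_squared_differences:
  fixes c :: "'a \<Rightarrow> real"
  assumes A: "A \<in> samples U n" and c: "sum c U = 0"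
  shows "(\<Sum>i\<in>A. \<Sum>j\<in>U - A. (c j - c i)\<^sup>2) =
    (real (card U) - 2 * real n) * (\<Sum>i\<in>A. (c i)\<^sup>2) + real n * (\<Sum>i\<in>U. (c i)\<^sup>2) + 2 * (sum c A)\<^sup>2"
proof -
  have "(\<Sum>i\<in>A. \<Sum>j\<in>U - A. (c j - c i)\<^sup>2) =
    real (card A) * (\<Sum>j\<in>U - A. (c j)\<^sup>2) + real (card (U - A)) * (\<Sum>i\<in>A. (c i)\<^sup>2)
    - 2 * (sum c A * sum c (U - A))"
    by (simp add: power2_diff sum.distrib sum_subtractf sum_product)
       (simp add: sum_distrib_left sum_distrib_right mult_ac)
  also have "\<dots> = (real (card U) - 2 * real n) * (\<Sum>i\<in>A. (c i)\<^sup>2) + real n * (\<Sum>i\<in>U. (c i)\<^sup>2) + 2 * (sum c A)\<^sup>2"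
    using A c n_less
    by (simp add: sum_complement card_complement of_nat_diff algebra_simps power2_eq_square)
      (simp add: samples_def algebra_simps)
  finally show ?thesis .
qed

text \<open>
  Stein's identity for \<open>f x = x\<close>. The right-hand side contains \<open>2 E[T\<^sup>2]\<close> once more, so the identity is a linear
  equation for the variance; this is where the factor \<open>N - 1\<close> comes from.
\<close>

lemma E_sum_square:
  fixes c :: "'a \<Rightarrow> real"
  assumes c: "sum c U = 0"
  shows "E (\<lambda>A. (sum c A)\<^sup>2) =
    real n * (real (card U) - real n) / (real (card U) * (real (card U) - 1)) * (\<Sum>i\<in>U. (c i)\<^sup>2)"
proof -
  define N where "N = real (card U)"
  define S where "S = (\<Sum>i\<in>U. (c i)\<^sup>2)"
  define V where "V = E (\<lambda>A. (sum c A)\<^sup>2)"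
  have N: "N > 1" using n_less n_pos by (simp add: N_def)
  have "2 * N * V = E (\<lambda>A. \<Sum>i\<in>A. \<Sum>j\<in>U - A. (c j - c i)\<^sup>2)"
    using stein_identity[OF c, of "\<lambda>x. x"] by (simp add: power2_eq_square N_def V_def)
  also have "\<dots> = E (\<lambda>A. (N - 2 * real n) * (\<Sum>i\<in>A. (c i)\<^sup>2) + real n * S + 2 * (sum c A)\<^sup>2)"
    unfolding N_def S_def by (rule E_cong) (rule sum_pair_squared_differences[OF _ c])
  also have "\<dots> = (N - 2 * real n) * (real n / N * S) + real n * S + 2 * V"
    using E_sum[of "\<lambda>i. (c i)\<^sup>2"] by (simp add: V_def S_def N_def)
  finally have "(2 * N - 2) * V = (N - 2 * real n) * (real n / N * S) + real n * S"
    by (simp add: algebra_simps)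
  then have "V = ((N - 2 * real n) * (real n / N * S) + real n * S) / (2 * N - 2)"
    using N by (simp add: field_simps)
  also have "\<dots> = real n * (N - real n) / (N * (N - 1)) * S"
    using N by (simp add: divide_simps) (simp add: algebra_simps)
  finally show ?thesis by (simp add: V_def N_def S_def)
qed

lemma variance_sum:
  fixes c :: "'a \<Rightarrow> real"
  shows "E (\<lambda>A. (sum c A - real n * (sum c U / real (card U)))\<^sup>2) =
    real n * (real (card U) - real n) / (real (card U) * (real (card U) - 1)) *
    (\<Sum>i\<in>U. (c i - sum c U / real (card U))\<^sup>2)"
proof -
  define b where "b = sum c U / real (card U)"
  have "card U > 0" using n_less by simp
  then have "sum (\<lambda>i. c i - b) U = 0" by (simp add: sum_subtractf b_def)
  from E_sum_square[OF this]
  have "E (\<lambda>A. (sum (\<lambda>i. c i - b) A)\<^sup>2) =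
    real n * (real (card U) - real n) / (real (card U) * (real (card U) - 1)) * (\<Sum>i\<in>U. (c i - b)\<^sup>2)" .
  also have "E (\<lambda>A. (sum (\<lambda>i. c i - b) A)\<^sup>2) = E (\<lambda>A. (sum c A - real n * b)\<^sup>2)"
    by (rule E_cong) (simp add: sum_subtractf samples_def)
  finally show ?thesis by (simp add: b_def)
qed

text \<open>
  The factor multiplying \<open>f'(T)\<close> in the linearized Stein identity is random with mean \<open>1\<close>, and the normal
  approximation needs it to be nearly constant. By \<open>sum_pair_squared_differences\<close> it deviates from \<open>1\<close> by
  \<open>(N - 2 n) / (2 N)\<close> times the centred sample sum of the \<open>(c i)\<^sup>2\<close>, plus \<open>(T\<^sup>2 - 1) / N\<close>. The former is again a
  linear statistic, so \<open>variance_sum\<close> bounds its variance, by \<open>M\<^sup>2\<close> times the variance of \<open>T\<close>.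
\<close>

lemma stein_kernel_concentration:
  fixes c :: "'a \<Rightarrow> real"
  assumes c: "sum c U = 0" and var: "E (\<lambda>A. (sum c A)\<^sup>2) = 1"
    and M: "\<And>i. i \<in> U \<Longrightarrow> \<bar>c i\<bar> \<le> M"
  shows "E (\<lambda>A. \<bar>(\<Sum>i\<in>A. \<Sum>j\<in>U - A. (c j - c i)\<^sup>2) / (2 * real (card U)) - 1\<bar>)
    \<le> M / 2 + 2 / real (card U)"
proof -
  define N where "N = real (card U)"
  define Q where "Q = (\<lambda>A. \<Sum>i\<in>A. (c i)\<^sup>2)"
  define q where "q = Q U / N"
  define r where "r = real n * (N - real n) / (N * (N - 1))"
  have N: "N > 1" "real n < N" using n_less n_pos by (auto simp: N_def)
  have r: "r \<ge> 0" using N by (simp add: r_def)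
  have rQ: "r * Q U = 1"
    using var unfolding E_sum_square[OF c] r_def N_def Q_def .
  have M_pos: "M > 0"
  proof (rule ccontr)
    assume "\<not> M > 0"
    then have "c i = 0" if "i \<in> U" for i using M[OF that] by simp
    then have "Q U = 0" unfolding Q_def by (intro sum.neutral) simp
    then show False using rQ by simp
  qed
  have "E (\<lambda>A. (Q A - real n * q)\<^sup>2) = r * (\<Sum>i\<in>U. ((c i)\<^sup>2 - q)\<^sup>2)"
    using variance_sum[of "\<lambda>i. (c i)\<^sup>2"] by (simp add: Q_def q_def r_def N_def)
  also have "(\<Sum>i\<in>U. ((c i)\<^sup>2 - q)\<^sup>2) = (\<Sum>i\<in>U. ((c i)\<^sup>2)\<^sup>2) - N * q\<^sup>2"
  proof -
    have "(\<Sum>i\<in>U. ((c i)\<^sup>2 - q)\<^sup>2) = (\<Sum>i\<in>U. ((c i)\<^sup>2)\<^sup>2) + N * q\<^sup>2 - 2 * q * Q U"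
      unfolding power2_diff by (simp add: sum.distrib sum_subtractf N_def Q_def sum_distrib_left mult_ac)
    also have "Q U = N * q" using N by (simp add: q_def)
    finally show ?thesis by (simp add: power2_eq_square)
  qed
  also have "r * ((\<Sum>i\<in>U. ((c i)\<^sup>2)\<^sup>2) - N * q\<^sup>2) \<le> r * (M\<^sup>2 * Q U)"
  proof (rule mult_left_mono[OF _ r])
    have "(\<Sum>i\<in>U. ((c i)\<^sup>2)\<^sup>2) \<le> (\<Sum>i\<in>U. M\<^sup>2 * (c i)\<^sup>2)"
    proof (rule sum_mono)
      fix i assume "i \<in> U"
      then have "(c i)\<^sup>2 \<le> M\<^sup>2" using M[of i] M_pos by (metis abs_le_square_iff abs_of_pos)
      then show "((c i)\<^sup>2)\<^sup>2 \<le> M\<^sup>2 * (c i)\<^sup>2" unfolding power2_eq_square[of "(c i)\<^sup>2"] by (intro mult_right_mono) auto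
    qed
    also have "\<dots> = M\<^sup>2 * Q U" by (simp add: Q_def sum_distrib_left)
    finally have "(\<Sum>i\<in>U. ((c i)\<^sup>2)\<^sup>2) \<le> M\<^sup>2 * Q U" .
    moreover have "0 \<le> N * q\<^sup>2" using N by simp
    ultimately show "(\<Sum>i\<in>U. ((c i)\<^sup>2)\<^sup>2) - N * q\<^sup>2 \<le> M\<^sup>2 * Q U" by linarith
  qed
  also have "\<dots> = M\<^sup>2" using rQ by (simp add: mult.left_commute)
  finally have VQ: "E (\<lambda>A. (Q A - real n * q)\<^sup>2) \<le> M\<^sup>2" .
  have "E (\<lambda>A. \<bar>(\<Sum>i\<in>A. \<Sum>j\<in>U - A. (c j - c i)\<^sup>2) / (2 * N) - 1\<bar>)
    \<le> E (\<lambda>A. ((Q A - real n * q)\<^sup>2 / M + M) / 4 + ((sum c A)\<^sup>2 + 1) / N)"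
  proof (rule E_mono)
    fix A assume A: "A \<in> samples U n"
    have id: "(\<Sum>i\<in>A. \<Sum>j\<in>U - A. (c j - c i)\<^sup>2) / (2 * N) - 1
      = (N - 2 * real n) / (2 * N) * (Q A - real n * q) + ((sum c A)\<^sup>2 - 1) / N"
    proof -
      have one: "2 * (real n * (N - real n)) * Q U = 2 * N * (N - 1)"
        using rQ N by (simp add: r_def field_simps)
      have "(\<Sum>i\<in>A. \<Sum>j\<in>U - A. (c j - c i)\<^sup>2) / (2 * N) - 1 -
         ((N - 2 * real n) / (2 * N) * (Q A - real n * q) + ((sum c A)\<^sup>2 - 1) / N)
        = (2 * (real n * (N - real n)) * Q U - 2 * N * (N - 1)) / (2 * N\<^sup>2)"
        unfolding sum_pair_squared_differences[OF A c] q_def Q_def[symmetric] N_def[symmetric]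
        using N unfolding Q_def[symmetric] by (simp add: divide_simps) (simp add: algebra_simps power2_eq_square)
      also have "\<dots> = 0" unfolding one by simp
      finally show ?thesis by simp
    qed
    have "\<bar>(N - 2 * real n) / (2 * N) * (Q A - real n * q)\<bar> \<le> 1 / 2 * \<bar>Q A - real n * q\<bar>"
      unfolding abs_mult using N by (intro mult_right_mono) (auto simp: divide_simps abs_if)
    \<comment> \<open>The inequality between arithmetic and geometric mean, with weight \<open>M\<close>, replaces Cauchy-Schwarz.\<close>
    also have "\<bar>Q A - real n * q\<bar> \<le> ((Q A - real n * q)\<^sup>2 / M + M) / 2"
    proof -
      have "0 \<le> (\<bar>Q A - real n * q\<bar> - M)\<^sup>2" by simp
      then have "2 * \<bar>Q A - real n * q\<bar> * M \<le> (Q A - real n * q)\<^sup>2 + M\<^sup>2" by (simp add: power2_diff)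
      then show ?thesis using M_pos by (simp add: field_simps power2_eq_square)
    qed
    finally have 1: "\<bar>(N - 2 * real n) / (2 * N) * (Q A - real n * q)\<bar>
        \<le> ((Q A - real n * q)\<^sup>2 / M + M) / 4" by simp
    have "\<bar>((sum c A)\<^sup>2 - 1) / N\<bar> \<le> ((sum c A)\<^sup>2 + 1) / N"
      using N by (simp add: divide_right_mono abs_le_iff)
    with 1 show "\<bar>(\<Sum>i\<in>A. \<Sum>j\<in>U - A. (c j - c i)\<^sup>2) / (2 * N) - 1\<bar>
      \<le> ((Q A - real n * q)\<^sup>2 / M + M) / 4 + ((sum c A)\<^sup>2 + 1) / N"
      unfolding id by linarith
  qed
  also have "\<dots> = (E (\<lambda>A. (Q A - real n * q)\<^sup>2) / M + M) / 4 + 2 / N"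
    using var by simp
  also have "\<dots> \<le> (M\<^sup>2 / M + M) / 4 + 2 / N"
    using VQ M_pos by (simp add: divide_right_mono)
  also have "\<dots> = M / 2 + 2 / N" using M_pos by (simp add: power2_eq_square)
  finally show ?thesis by (simp add: N_def)
qed

text \<open>
  Stein's identity for \<open>f x = exp (\<i> t x)\<close>, whose left-hand side is \<open>- \<i> \<phi>'(t)\<close> up to the factor \<open>2 N\<close>. Linearizing \<open>f\<close> costs
  \<open>t\<^sup>2 \<bar>d\<bar>\<^sup>3 / 2 \<le> t\<^sup>2 M d\<^sup>2\<close> for each exchange; the remaining term is handled by \<open>stein_kernel_concentration\<close>.
\<close>

lemma stein_identity_iexp:
  fixes c :: "'a \<Rightarrow> real" and t :: real
  assumes c: "sum c U = 0" and var: "E (\<lambda>A. (sum c A)\<^sup>2) = 1"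
    and M: "\<And>i. i \<in> U \<Longrightarrow> \<bar>c i\<bar> \<le> M"
  shows "cmod (E (\<lambda>A. sum c A *\<^sub>R iexp (t * sum c A)) - (\<i> * t) * E (\<lambda>A. iexp (t * sum c A)))
    \<le> t\<^sup>2 * M + \<bar>t\<bar> * (M / 2 + 2 / real (card U))"
proof -
  define N where "N = real (card U)"
  define K where "K = (\<lambda>A. (\<Sum>i\<in>A. \<Sum>j\<in>U - A. (c j - c i)\<^sup>2) / (2 * N))"
  define f where "f = (\<lambda>x. iexp (t * x))"
  have N: "N > 0" using n_less by (simp add: N_def)
  have "2 * N * E (\<lambda>A. (sum c A)\<^sup>2) = E (\<lambda>A. \<Sum>i\<in>A. \<Sum>j\<in>U - A. (c j - c i)\<^sup>2)"
    using stein_identity[OF c, of "\<lambda>x. x"] by (simp add: power2_eq_square N_def)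
  then have EK: "E K = 1" unfolding K_def using N var by simp
  have taylor: "cmod (f (x + d) - f x - (\<i> * t) * (d *\<^sub>R f x)) \<le> t\<^sup>2 * d\<^sup>2 / 2" for x d
  proof -
    have "f (x + d) - f x - (\<i> * t) * (d *\<^sub>R f x) = f x * (iexp (t * d) - (\<Sum>k\<le>1. (\<i> * complex_of_real (t * d)) ^ k / fact k))"
      by (simp add: f_def distrib_left exp_add algebra_simps scaleR_conv_of_real)
    then have "cmod (f (x + d) - f x - (\<i> * t) * (d *\<^sub>R f x)) = cmod (iexp (t * d) - (\<Sum>k\<le>1. (\<i> * complex_of_real (t * d)) ^ k / fact k))"
      by (simp add: norm_mult f_def del: of_real_mult)
    also have "\<dots> \<le> \<bar>t * d\<bar> ^ Suc 1 / fact (Suc 1)" by (rule iexp_approx1)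
    also have "\<dots> = t\<^sup>2 * d\<^sup>2 / 2" by (simp add: power_mult_distrib flip: abs_mult power2_eq_square) 
    finally show ?thesis .
  qed
  have T: "E (\<lambda>A. sum c A *\<^sub>R f (sum c A)) =
    E (\<lambda>A. (\<Sum>i\<in>A. \<Sum>j\<in>U - A. (c j - c i) *\<^sub>R (f (sum c A + (c j - c i)) - f (sum c A))) /\<^sub>R (2 * N))"
  proof -
    have "E (\<lambda>A. sum c A *\<^sub>R f (sum c A)) = ((2 * N) *\<^sub>R E (\<lambda>A. sum c A *\<^sub>R f (sum c A))) /\<^sub>R (2 * N)"
      using N by simp
    then show ?thesis using stein_identity[OF c, of f] by (simp add: N_def)
  qed
  have 1: "cmod (E (\<lambda>A. sum c A *\<^sub>R f (sum c A)) - E (\<lambda>A. (\<i> * t) * (K A *\<^sub>R f (sum c A)))) \<le> t\<^sup>2 * M"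
  proof -
    have "cmod (E (\<lambda>A. sum c A *\<^sub>R f (sum c A)) - E (\<lambda>A. (\<i> * t) * (K A *\<^sub>R f (sum c A))))
      = cmod (E (\<lambda>A. (\<Sum>i\<in>A. \<Sum>j\<in>U - A. (c j - c i) *\<^sub>R (f (sum c A + (c j - c i)) - f (sum c A))) /\<^sub>R (2 * N)
             - (\<i> * t) * (K A *\<^sub>R f (sum c A))))"
      unfolding T by (simp only: Bochner_Integration.integral_diff[OF integrable_P integrable_P])
    also have "\<dots> \<le> E (\<lambda>A. cmod ((\<Sum>i\<in>A. \<Sum>j\<in>U - A. (c j - c i) *\<^sub>R (f (sum c A + (c j - c i)) - f (sum c A))) /\<^sub>R (2 * N)
             - (\<i> * t) * (K A *\<^sub>R f (sum c A))))"
      by (rule integral_norm_bound)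
    also have "\<dots> \<le> E (\<lambda>A. t\<^sup>2 * M * K A)"
    proof (rule E_mono)
      fix A assume A: "A \<in> samples U n"
      let ?d = "\<lambda>i j. c j - c i"
      have scale_norm: "cmod (X /\<^sub>R (2 * N)) \<le> r / (2 * N)" if "cmod X \<le> r" for X r
      proof -
        have "cmod (X /\<^sub>R (2 * N)) = cmod X / (2 * N)"
          using N by (simp only: norm_scaleR divide_inverse mult.commute[of "inverse _"]) simp
        also have "\<dots> \<le> r / (2 * N)" using that N by (intro divide_right_mono) auto
        finally show ?thesis .
      qed
      have scale: "X /\<^sub>R (2 * N) - z * ((S / (2 * N)) *\<^sub>R a) = (X - z * (S *\<^sub>R a)) /\<^sub>R (2 * N)"
        for X z a :: complex and S :: real
        by (simp only: scaleR_diff_right mult_scaleR_right scaleR_scaleR divide_inverse mult.commute[of S])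
      have rem: "(\<Sum>i\<in>A. \<Sum>j\<in>U - A. ?d i j *\<^sub>R (f (sum c A + ?d i j) - f (sum c A))) /\<^sub>R (2 * N)
             - (\<i> * t) * (K A *\<^sub>R f (sum c A)) =
        (\<Sum>i\<in>A. \<Sum>j\<in>U - A. ?d i j *\<^sub>R (f (sum c A + ?d i j) - f (sum c A) - (\<i> * t) * (?d i j *\<^sub>R f (sum c A)))) /\<^sub>R (2 * N)"
        unfolding sum_taylor_remainder[where d = ?d and F = "\<lambda>i j. f (sum c A + ?d i j)"] K_def
        by (rule scale)
      have "cmod (\<Sum>i\<in>A. \<Sum>j\<in>U - A. ?d i j *\<^sub>R (f (sum c A + ?d i j) - f (sum c A) - (\<i> * t) * (?d i j *\<^sub>R f (sum c A))))
          \<le> (\<Sum>i\<in>A. \<Sum>j\<in>U - A. t\<^sup>2 * M * (?d i j)\<^sup>2)"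
      proof (intro sum_norm_le)
          fix i j assume ij: "i \<in> A" "j \<in> U - A"
          have "i \<in> U" "j \<in> U" using A ij by (auto simp: samples_def)
          then have d: "\<bar>?d i j\<bar> \<le> 2 * M" using M[of i] M[of j] by simp
          have "cmod (?d i j *\<^sub>R (f (sum c A + ?d i j) - f (sum c A) - (\<i> * t) * (?d i j *\<^sub>R f (sum c A))))
            \<le> \<bar>?d i j\<bar> * (t\<^sup>2 * (?d i j)\<^sup>2 / 2)"
            unfolding norm_scaleR using taylor by (intro mult_left_mono) auto
          also have "\<dots> \<le> (2 * M) * (t\<^sup>2 * (?d i j)\<^sup>2 / 2)" using d by (intro mult_right_mono) auto
          finally show "cmod (?d i j *\<^sub>R (f (sum c A + ?d i j) - f (sum c A) - (\<i> * t) * (?d i j *\<^sub>R f (sum c A))))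
            \<le> t\<^sup>2 * M * (?d i j)\<^sup>2" by (simp add: mult_ac)
        qed
      note scale_norm[OF this]
      moreover have "(\<Sum>i\<in>A. \<Sum>j\<in>U - A. t\<^sup>2 * M * (?d i j)\<^sup>2) / (2 * N) = t\<^sup>2 * M * K A"
        by (simp add: K_def sum_distrib_left)
      ultimately show "cmod ((\<Sum>i\<in>A. \<Sum>j\<in>U - A. ?d i j *\<^sub>R (f (sum c A + ?d i j) - f (sum c A))) /\<^sub>R (2 * N)
             - (\<i> * t) * (K A *\<^sub>R f (sum c A))) \<le> t\<^sup>2 * M * K A"
        unfolding rem by (simp only:)
    qed
    also have "\<dots> = t\<^sup>2 * M" using EK by simp
    finally show ?thesis .
  qed
  have 2: "cmod (E (\<lambda>A. (\<i> * t) * (K A *\<^sub>R f (sum c A))) - (\<i> * t) * E (\<lambda>A. f (sum c A)))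
    \<le> \<bar>t\<bar> * (M / 2 + 2 / N)"
  proof -
    have "E (\<lambda>A. (\<i> * t) * (K A *\<^sub>R f (sum c A))) - (\<i> * t) * E (\<lambda>A. f (sum c A))
      = E (\<lambda>A. (\<i> * t) * (K A *\<^sub>R f (sum c A)) - (\<i> * t) * f (sum c A))"
      by (simp only: Bochner_Integration.integral_diff[OF integrable_P integrable_P] integral_mult_right_zero)
    also have "cmod \<dots> \<le> E (\<lambda>A. cmod ((\<i> * t) * (K A *\<^sub>R f (sum c A)) - (\<i> * t) * f (sum c A)))"
      by (rule integral_norm_bound)
    also have "\<dots> = E (\<lambda>A. \<bar>t\<bar> * \<bar>K A - 1\<bar>)"
    proof (rule E_cong)
      fix A
      have "(\<i> * t) * (K A *\<^sub>R f (sum c A)) - (\<i> * t) * f (sum c A) = (\<i> * t) * ((K A - 1) *\<^sub>R f (sum c A))"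
        by (simp add: algebra_simps)
      then show "cmod ((\<i> * t) * (K A *\<^sub>R f (sum c A)) - (\<i> * t) * f (sum c A)) = \<bar>t\<bar> * \<bar>K A - 1\<bar>"
        by (simp add: norm_mult f_def)
    qed
    also have "\<dots> = \<bar>t\<bar> * E (\<lambda>A. \<bar>K A - 1\<bar>)" by simp
    also have "\<dots> \<le> \<bar>t\<bar> * (M / 2 + 2 / N)"
      using stein_kernel_concentration[OF c var M] by (intro mult_left_mono) (auto simp: K_def N_def)
    finally show ?thesis .
  qed
  have "cmod (E (\<lambda>A. sum c A *\<^sub>R f (sum c A)) - (\<i> * t) * E (\<lambda>A. f (sum c A)))
    \<le> t\<^sup>2 * M + \<bar>t\<bar> * (M / 2 + 2 / N)"
    using norm_triangle_le[OF add_mono[OF 1 2]] by simp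
  then show ?thesis by (simp add: f_def N_def)
qed

text \<open>
  A quantitative central limit theorem for sampling without replacement. By \<open>stein_identity_iexp\<close>,
  \<open>\<phi>' + t \<phi>\<close> is small, so the derivative of \<open>exp (t\<^sup>2 / 2) \<phi>(t)\<close> is at most the error times
  \<open>exp (t\<^sup>2 / 2)\<close>. Integrating from \<open>\<phi>(0) = 1\<close> and multiplying by \<open>exp (- t\<^sup>2 / 2)\<close> cancels the exponential.
\<close>

theorem char_sample_sum_bound:
  fixes c :: "'a \<Rightarrow> real" and t :: real
  assumes c: "sum c U = 0" and var: "E (\<lambda>A. (sum c A)\<^sup>2) = 1"
    and M: "\<And>i. i \<in> U \<Longrightarrow> \<bar>c i\<bar> \<le> M"
  shows "cmod (E (\<lambda>A. iexp (t * sum c A)) - exp (- t\<^sup>2 / 2))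
    \<le> \<bar>t\<bar> * (t\<^sup>2 * M + \<bar>t\<bar> * (M / 2 + 2 / real (card U)))"
proof -
  define \<phi> where "\<phi> = (\<lambda>s. E (\<lambda>A. iexp (s * sum c A)))"
  define \<phi>' where "\<phi>' = (\<lambda>s. \<i> * E (\<lambda>A. sum c A *\<^sub>R iexp (s * sum c A)))"
  define g where "g = (\<lambda>s. exp (s\<^sup>2 / 2) *\<^sub>R \<phi> s)"
  define g' where "g' = (\<lambda>s. exp (s\<^sup>2 / 2) *\<^sub>R (\<phi>' s + s *\<^sub>R \<phi> s))"
  define B where "B = t\<^sup>2 * M + \<bar>t\<bar> * (M / 2 + 2 / real (card U))"
  have "U \<noteq> {}" using n_less by auto
  then have M0: "M \<ge> 0" using M by fastforce
  have d\<phi>: "(\<phi> has_vector_derivative \<phi>' s) (at s within X)" for s X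
  proof -
    have "((\<lambda>s. iexp (s * x)) has_vector_derivative \<i> * (x *\<^sub>R iexp (s * x))) (at s within X)" for x :: real
    proof -
      have "((\<lambda>z. exp (\<i> * (z * x))) has_field_derivative \<i> * (x *\<^sub>R iexp (s * x))) (at (complex_of_real s))"
        by (auto intro!: derivative_eq_intros simp: scaleR_conv_of_real)
      from has_vector_derivative_real_field[OF this] show ?thesis by simp
    qed
    then have "((\<lambda>s. \<Sum>A\<in>samples U n. iexp (s * sum c A)) has_vector_derivative
        (\<Sum>A\<in>samples U n. \<i> * (sum c A *\<^sub>R iexp (s * sum c A)))) (at s within X)"
      by (intro has_vector_derivative_sum)
    from bounded_linear.has_vector_derivative[OF bounded_linear_scaleR_right this]
    show ?thesis
      unfolding \<phi>_def \<phi>'_def E_eq_sum mult_scaleR_right sum_distrib_left .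
  qed
  have dg: "(g has_vector_derivative g' s) (at s within X)" for s X
  proof -
    have "((\<lambda>s. exp (s\<^sup>2 / 2)) has_real_derivative exp (s\<^sup>2 / 2) * s) (at s within X)"
      by (auto intro!: derivative_eq_intros)
    from has_vector_derivative_scaleR[OF this d\<phi>]
    show ?thesis unfolding g_def g'_def by (simp add: algebra_simps)
  qed
  have bound: "norm (g' s) \<le> exp (t\<^sup>2 / 2) * B" if s: "\<bar>s\<bar> \<le> \<bar>t\<bar>" for s
  proof -
    have s2: "s\<^sup>2 \<le> t\<^sup>2" using s by (simp add: abs_le_square_iff)
    have "\<phi>' s + s *\<^sub>R \<phi> s = \<i> * (E (\<lambda>A. sum c A *\<^sub>R iexp (s * sum c A)) - (\<i> * s) * \<phi> s)"
      by (simp add: \<phi>'_def right_diff_distrib scaleR_conv_of_real flip: mult.assoc)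
    then have "cmod (\<phi>' s + s *\<^sub>R \<phi> s) \<le> s\<^sup>2 * M + \<bar>s\<bar> * (M / 2 + 2 / real (card U))"
      using stein_identity_iexp[OF c var M, of s] by (simp add: norm_mult \<phi>_def)
    also have "\<dots> \<le> B" unfolding B_def using s s2 M0 by (intro add_mono mult_right_mono) auto
    finally have "cmod (\<phi>' s + s *\<^sub>R \<phi> s) \<le> B" .
    then show ?thesis unfolding g'_def norm_scaleR using s2 by (auto intro!: mult_mono)
  qed
  have "norm (g t - g 0) \<le> exp (t\<^sup>2 / 2) * B * norm (t - 0)"
  proof (rule differentiable_bound[where S = "closed_segment 0 t" and f' = "\<lambda>s h. h *\<^sub>R g' s"])
    show "(g has_derivative (\<lambda>h. h *\<^sub>R g' s)) (at s within closed_segment 0 t)" for s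
      using dg[of s] by (simp add: has_vector_derivative_def)
    show "onorm (\<lambda>h. h *\<^sub>R g' s) \<le> exp (t\<^sup>2 / 2) * B" if "s \<in> closed_segment 0 t" for s
    proof (rule onorm_le)
      fix h
      have "\<bar>s\<bar> \<le> \<bar>t\<bar>" using that by (auto simp: closed_segment_eq_real_ivl split: if_splits)
      from bound[OF this] show "norm (h *\<^sub>R g' s) \<le> exp (t\<^sup>2 / 2) * B * norm h"
        by (simp add: mult.commute mult_left_mono)
    qed
  qed auto
  moreover have "g 0 = 1" by (simp add: g_def \<phi>_def)
  ultimately have main: "norm (g t - 1) \<le> exp (t\<^sup>2 / 2) * (\<bar>t\<bar> * B)" by (simp add: mult_ac)
  have inv: "exp (- t\<^sup>2 / 2) * exp (t\<^sup>2 / 2) = 1" by (simp flip: exp_add)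
  have "\<phi> t - exp (- t\<^sup>2 / 2) = exp (- t\<^sup>2 / 2) *\<^sub>R (g t - 1)"
    unfolding g_def scaleR_diff_right scaleR_scaleR inv by (simp add: scaleR_conv_of_real)
  then have "cmod (\<phi> t - exp (- t\<^sup>2 / 2)) = exp (- t\<^sup>2 / 2) * norm (g t - 1)" by simp
  also have "\<dots> \<le> exp (- t\<^sup>2 / 2) * (exp (t\<^sup>2 / 2) * (\<bar>t\<bar> * B))" using main by (intro mult_left_mono) auto
  also have "\<dots> = \<bar>t\<bar> * B" by (simp flip: exp_add mult.assoc)
  finally show ?thesis by (simp add: \<phi>_def B_def)
qed

end

section \<open>Delta method and convergence in probability\<close>

lemma ln_taylor_bound:
  fixes x p :: real
  assumes \<delta>: "0 < \<delta>" "\<delta> \<le> p" and x: "\<bar>x - p\<bar> \<le> \<delta> / 2"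
  shows "\<bar>ln x - ln p - (x - p) / p\<bar> \<le> 2 / \<delta>\<^sup>2 * (x - p)\<^sup>2"
proof -
  have pos: "p > 0" "x > 0" using assms by (auto simp: abs_if split: if_splits)
  have "\<bar>(x - p) / p\<bar> \<le> 1 / 2"
    using assms pos by (simp add: abs_divide divide_le_eq)
  from abs_ln_one_plus_x_minus_x_bound[OF this]
  have "\<bar>ln x - ln p - (x - p) / p\<bar> \<le> 2 * ((x - p) / p)\<^sup>2"
    using pos by (simp add: diff_divide_distrib ln_div)
  also have "((x - p) / p)\<^sup>2 \<le> (x - p)\<^sup>2 / \<delta>\<^sup>2"
    unfolding power_divide using \<delta> by (intro divide_left_mono power_mono mult_pos_pos) auto
  finally show ?thesis by simp
qed

lemma logit_taylor_bound:
  fixes x p :: real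
  assumes \<delta>: "0 < \<delta>" "\<delta> \<le> p" "p \<le> 1 - \<delta>" and x: "\<bar>x - p\<bar> \<le> \<delta> / 2"
  shows "\<bar>logit x - logit p - (x - p) / (p * (1 - p))\<bar> \<le> 4 / \<delta>\<^sup>2 * (x - p)\<^sup>2"
proof -
  have "\<bar>ln (1 - x) - ln (1 - p) - ((1 - x) - (1 - p)) / (1 - p)\<bar> \<le> 2 / \<delta>\<^sup>2 * ((1 - x) - (1 - p))\<^sup>2"
    using assms by (intro ln_taylor_bound) (auto simp: abs_minus_commute)
  then have "\<bar>ln (1 - x) - ln (1 - p) - ((1 - x) - (1 - p)) / (1 - p)\<bar> \<le> 2 / \<delta>\<^sup>2 * (x - p)\<^sup>2"
    by (simp add: power2_commute)
  moreover have "\<bar>ln x - ln p - (x - p) / p\<bar> \<le> 2 / \<delta>\<^sup>2 * (x - p)\<^sup>2"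
    using assms by (intro ln_taylor_bound) auto
  moreover have "(x - p) / (p * (1 - p)) = (x - p) / p - ((1 - x) - (1 - p)) / (1 - p)"
    using assms by (simp add: divide_simps) (simp add: algebra_simps)
  ultimately show ?thesis unfolding logit_def by (simp add: abs_le_iff)
qed

lemma cmod_iexp_diff_le: "cmod (iexp a - iexp b) \<le> \<bar>a - b\<bar>"
proof -
  have "iexp a - iexp b = iexp b * (iexp (a - b) - 1)"
    by (simp add: right_diff_distrib flip: exp_add distrib_left of_real_add)
  then have "cmod (iexp a - iexp b) = cmod (iexp (a - b) - 1)"
    by (simp add: norm_mult del: of_real_diff)
  also have "\<dots> \<le> \<bar>a - b\<bar>" using iexp_approx1[of "a - b" 0] by simp
  finally show ?thesis .
qed

text \<open>
  Convergence in probability by comparison with a nonnegative \<open>D\<close> that tends to \<open>0\<close> in mean, by Markov's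
  inequality. The comparison may use that \<open>k\<close> is large, since the variance estimator has a deterministic bias of
  order \<open>1 / N\<close>. Below, \<open>D\<close> is the squared error of the estimated proportions.
\<close>

lemma tendsto_in_prob_if_controlled:
  fixes X D :: "nat \<Rightarrow> 'w \<Rightarrow> real"
  assumes fin: "\<And>k. finite (set_pmf (P k))"
    and D_nonneg: "\<And>k \<omega>. 0 \<le> D k \<omega>"
    and D_lim: "(\<lambda>k. measure_pmf.expectation (P k) (D k)) \<longlonglongrightarrow> 0"
    and ctrl: "\<And>\<epsilon>. 0 < \<epsilon> \<Longrightarrow> \<exists>\<eta>>0. \<forall>\<^sub>F k in sequentially.
      \<forall>\<omega>\<in>set_pmf (P k). D k \<omega> \<le> \<eta> \<longrightarrow> \<bar>X k \<omega> - c\<bar> \<le> \<epsilon>"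
  shows "tendsto_in_prob P X c"
  unfolding tendsto_in_prob_def
proof (intro allI impI)
  fix \<epsilon> :: real assume "\<epsilon> > 0"
  then obtain \<eta> where \<eta>: "\<eta> > 0" and ev: "\<forall>\<^sub>F k in sequentially.
      \<forall>\<omega>\<in>set_pmf (P k). D k \<omega> \<le> \<eta> \<longrightarrow> \<bar>X k \<omega> - c\<bar> \<le> \<epsilon>" using ctrl by blast
  have bound: "\<forall>\<^sub>F k in sequentially. measure_pmf.prob (P k) {\<omega>. \<bar>X k \<omega> - c\<bar> > \<epsilon>}
      \<le> measure_pmf.expectation (P k) (D k) / \<eta>"
    using ev
  proof eventually_elim
    case (elim k)
    have "measure_pmf.prob (P k) {\<omega>. \<bar>X k \<omega> - c\<bar> > \<epsilon>} \<le> measure_pmf.prob (P k) {\<omega>. D k \<omega> \<ge> \<eta>}"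
      using elim by (intro measure_pmf.finite_measure_mono_AE) (force simp: AE_measure_pmf_iff)+
    also have "\<dots> \<le> measure_pmf.expectation (P k) (D k) / \<eta>"
      using integral_Markov_inequality_measure[of "measure_pmf (P k)" "D k" "{}" \<eta>] D_nonneg \<eta>
        integrable_measure_pmf_finite[OF fin, of k "D k"] by simp
    finally show ?case .
  qed
  show "(\<lambda>k. measure_pmf.prob (P k) {\<omega>. \<bar>X k \<omega> - c\<bar> > \<epsilon>}) \<longlonglongrightarrow> 0"
    by (rule tendsto_sandwich[OF _ bound tendsto_const tendsto_divide_zero[OF D_lim]]) simp
qed

section \<open>Estimation errors in a randomized experiment\<close>

lemma card_binary_eq_sum:
  fixes y :: "'a \<Rightarrow> real"
  assumes "finite B" "\<And>i. i \<in> B \<Longrightarrow> y i \<in> {0, 1}"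
  shows "real (card {i \<in> B. y i = 1}) = sum y B" "real (card {i \<in> B. y i = 0}) = real (card B) - sum y B"
proof -
  have "sum y B = (\<Sum>i\<in>B. if y i = 1 then 1 else 0)"
    using assms(2) by (intro sum.cong) auto
  also have "\<dots> = real (card {i \<in> B. y i = 1})"
    using assms(1) by (simp add: sum.If_cases Int_def)
  finally show 1: "real (card {i \<in> B. y i = 1}) = sum y B" ..
  have "{i \<in> B. y i = 0} = B - {i \<in> B. y i = 1}" using assms(2) by auto
  then have "card {i \<in> B. y i = 0} = card B - card {i \<in> B. y i = 1}"
    using assms(1) by (simp add: card_Diff_subset)
  moreover have "card {i \<in> B. y i = 1} \<le> card B" using assms(1) by (intro card_mono) auto
  ultimately show "real (card {i \<in> B. y i = 0}) = real (card B) - sum y B" using 1 by simp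
qed

definition treated :: "nat \<Rightarrow> (nat \<Rightarrow> real) \<Rightarrow> nat set" where
  "treated N W = {i \<in> {1..N}. W i = 1}"

lemma bij_betw_treated: "bij_betw (treated N) (assignments N n) (samples {1..N} n)"
proof (rule bij_betw_byWitness[where f' = "\<lambda>A. \<lambda>i\<in>{1..N}. if i \<in> A then 1 else 0"])
  show "\<forall>W\<in>assignments N n. (\<lambda>i\<in>{1..N}. if i \<in> treated N W then 1 else 0) = W"
  proof
    fix W assume "W \<in> assignments N n"
    then have W: "W \<in> {1..N} \<rightarrow>\<^sub>E {0, 1}" by (simp add: assignments_def)
    show "(\<lambda>i\<in>{1..N}. if i \<in> treated N W then 1 else 0) = W"
    proof
      fix i show "(\<lambda>i\<in>{1..N}. if i \<in> treated N W then 1 else 0) i = W i"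
        using W by (cases "i \<in> {1..N}") (auto simp: treated_def PiE_iff extensional_def)
    qed
  qed
  have inverse: "treated N (\<lambda>i\<in>{1..N}. if i \<in> A then 1 else 0) = A" if "A \<subseteq> {1..N}" for A
    using that by (auto simp: treated_def)
  then show "\<forall>A\<in>samples {1..N} n. treated N (\<lambda>i\<in>{1..N}. if i \<in> A then 1 else 0) = A"
    by (auto simp: samples_def)
  show "treated N ` assignments N n \<subseteq> samples {1..N} n"
    by (auto simp: treated_def assignments_def samples_def)
  show "(\<lambda>A. \<lambda>i\<in>{1..N}. if i \<in> A then 1 else 0) ` samples {1..N} n \<subseteq> assignments N n"
  proof (rule image_subsetI)
    fix A assume A: "A \<in> samples {1..N} n"
    then show "(\<lambda>i\<in>{1..N}. if i \<in> A then 1 else 0) \<in> assignments N n"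
      using inverse[of A] by (simp add: assignments_def samples_def treated_def)
  qed
qed

(* Arm 1 and the population {1..N} are written with the numeral 1; rewriting it to Suc 0 would
   keep the simplifier from matching terms about them with the facts below. *)
declare One_nat_def [simp del]

locale randomized_experiment =
  fixes N N1 :: nat and Y :: "nat \<Rightarrow> nat \<Rightarrow> real"
  assumes binary: "\<And>t i. t \<in> {0, 1} \<Longrightarrow> i \<in> {1..N} \<Longrightarrow> Y t i \<in> {0, 1}"
    and treated_pos: "0 < N1" and control_pos: "N1 < N"
begin

sublocale srs: simple_random_sampling "{1..N}" N1
  by unfold_locales (use treated_pos control_pos in auto)

abbreviation p :: "nat \<Rightarrow> real" where
  "p t \<equiv> p_of N Y t"

abbreviation v :: "nat \<Rightarrow> real" where
  "v t \<equiv> p t * (1 - p t)"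

abbreviation N0 :: nat where
  "N0 \<equiv> N - N1"

abbreviation E_rand :: "((nat \<Rightarrow> real) \<Rightarrow> 'b::{banach, second_countable_topology}) \<Rightarrow> 'b" where
  "E_rand f \<equiv> measure_pmf.expectation (randomization N N1) f"

lemma sizes: "0 < real N1" "0 < real N0" "1 < real N"
  using treated_pos control_pos by auto

lemma N_split: "real N = real N1 + real N0"
  using control_pos by (simp add: of_nat_diff)

lemma finite_assignments: "finite (assignments N N1)"
  using bij_betw_finite[OF bij_betw_treated] srs.finite_samples by blast

lemma assignments_nonempty: "assignments N N1 \<noteq> {}"
  using bij_betw_treated[of N N1] srs.samples_nonempty by (auto simp: bij_betw_def)

lemma set_randomization: "set_pmf (randomization N N1) = assignments N N1"
  unfolding randomization_def by (rule set_pmf_of_set[OF assignments_nonempty finite_assignments])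

lemma integrable_randomization [simp]:
  fixes f :: "(nat \<Rightarrow> real) \<Rightarrow> 'b::{banach, second_countable_topology}"
  shows "integrable (measure_pmf (randomization N N1)) f"
  by (rule integrable_measure_pmf_finite) (simp add: set_randomization finite_assignments)

lemma treated_sample: "W \<in> assignments N N1 \<Longrightarrow> treated N W \<in> samples {1..N} N1"
  using bij_betw_treated by (auto simp: bij_betw_def)

lemma E_rand_eq:
  fixes f :: "(nat \<Rightarrow> real) \<Rightarrow> 'b::{banach, second_countable_topology}"
  assumes "\<And>W. W \<in> assignments N N1 \<Longrightarrow> f W = g (treated N W)"
  shows "E_rand f = srs.E g"
proof -
  have "E_rand f = E_rand (\<lambda>W. g (treated N W))"
    by (rule integral_cong_AE) (auto simp: AE_measure_pmf_iff set_randomization assms)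
  also have "\<dots> = measure_pmf.expectation (map_pmf (treated N) (randomization N N1)) g"
    by simp
  also have "map_pmf (treated N) (randomization N N1) = srs.P"
    unfolding randomization_def
    by (rule map_pmf_of_set_bij_betw[OF bij_betw_treated assignments_nonempty finite_assignments])
  finally show ?thesis .
qed

lemma E_rand_mono:
  fixes f g :: "(nat \<Rightarrow> real) \<Rightarrow> real"
  assumes "\<And>W. W \<in> assignments N N1 \<Longrightarrow> f W \<le> g W"
  shows "E_rand f \<le> E_rand g"
  by (rule integral_mono_AE) (auto simp: AE_measure_pmf_iff set_randomization assms)

lemma observed_counts:
  assumes W: "W \<in> assignments N N1"
  shows "real (n_obs N Y W 1 1) = sum (Y 1) (treated N W)"
    and "real (n_obs N Y W 1 0) = real N1 - sum (Y 1) (treated N W)"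
    and "real (n_obs N Y W 0 1) = sum (Y 0) ({1..N} - treated N W)"
    and "real (n_obs N Y W 0 0) = real N0 - sum (Y 0) ({1..N} - treated N W)"
proof -
  let ?A = "treated N W"
  have A: "?A \<in> samples {1..N} N1" by (rule treated_sample[OF W])
  have W01: "W i = 0 \<longleftrightarrow> i \<notin> ?A" if "i \<in> {1..N}" for i
    using W that by (auto simp: assignments_def treated_def PiE_iff)
  have "{i \<in> {1..N}. W i = 1 \<and> Y_obs Y W i = y} = {i \<in> ?A. Y 1 i = y}" for y
    by (auto simp: treated_def Y_obs_def)
  then have n1: "n_obs N Y W 1 y = card {i \<in> ?A. Y 1 i = y}" for y by (simp only: n_obs_def)
  have "{i \<in> {1..N}. W i = 0 \<and> Y_obs Y W i = y} = {i \<in> {1..N} - ?A. Y 0 i = y}" for y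
    using W01 by (force simp: Y_obs_def)
  then have n0: "n_obs N Y W 0 y = card {i \<in> {1..N} - ?A. Y 0 i = y}" for y by (simp only: n_obs_def)
  have fin: "finite ?A" by (rule srs.finite_sample[OF A])
  have cards: "card ?A = N1" "card ({1..N} - ?A) = N0"
    using A srs.card_complement[OF A] by (auto simp: samples_def)
  have b1: "Y 1 i \<in> {0, 1}" if "i \<in> ?A" for i using that by (intro binary) (auto simp: treated_def)
  have b0: "Y 0 i \<in> {0, 1}" if "i \<in> {1..N} - ?A" for i using that by (intro binary) auto
  show "real (n_obs N Y W 1 1) = sum (Y 1) ?A"
    unfolding n1 by (rule card_binary_eq_sum(1)[OF fin b1])
  show "real (n_obs N Y W 1 0) = real N1 - sum (Y 1) ?A"
    unfolding n1 using card_binary_eq_sum(2)[OF fin, of "Y 1"] b1 by (simp add: cards)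
  show "real (n_obs N Y W 0 1) = sum (Y 0) ({1..N} - ?A)"
    unfolding n0 by (rule card_binary_eq_sum(1)[OF _ b0]) auto
  show "real (n_obs N Y W 0 0) = real N0 - sum (Y 0) ({1..N} - ?A)"
    unfolding n0 by (subst card_binary_eq_sum(2)[OF _ b0]) (auto simp only: cards finite_Diff finite_atLeastAtMost)
qed

lemma sum_outcomes: "sum (Y t) {1..N} = real N * p t"
  using sizes by (simp add: p_of_def)

lemma p_hat1_eq:
  "W \<in> assignments N N1 \<Longrightarrow> p_hat1 N N1 Y W - p 1 = (sum (Y 1) (treated N W) - real N1 * p 1) / real N1"
  using sizes by (simp add: p_hat1_def observed_counts diff_divide_distrib)

text \<open>
  The control group is the complement of the treated sample, so its error is a statistic of the same sample with
  reversed sign.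
\<close>

lemma p_hat0_eq:
  assumes "W \<in> assignments N N1"
  shows "p_hat0 N N1 Y W - p 0 = - (sum (Y 0) (treated N W) - real N1 * p 0) / real N0"
proof -
  have "p_hat0 N N1 Y W = (real N * p 0 - sum (Y 0) (treated N W)) / real N0"
    unfolding p_hat0_def observed_counts[OF assms] srs.sum_complement[OF treated_sample[OF assms]] sum_outcomes ..
  moreover have "(n * q - s) / n0 - q = - (s - n1 * q) / n0" if "0 < n0" "n = n1 + n0" for n n0 n1 q s :: real
    using that by (simp add: field_simps)
  from this[OF sizes(2) N_split] have "(real N * p 0 - sum (Y 0) (treated N W)) / real N0 - p 0
    = - (sum (Y 0) (treated N W) - real N1 * p 0) / real N0" .
  ultimately show ?thesis by (simp only:)
qed

lemma sum_sq_dev: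
  assumes "t \<in> {0, 1}"
  shows "(\<Sum>i=1..N. (Y t i - p t)\<^sup>2) = real N * v t"
proof -
  have "(\<Sum>i=1..N. (Y t i - p t)\<^sup>2) = (\<Sum>i=1..N. (1 - 2 * p t) * Y t i + (p t)\<^sup>2)"
  proof (rule sum.cong[OF refl])
    fix i assume "i \<in> {1..N}"
    then have "Y t i = 0 \<or> Y t i = 1" using binary[OF assms] by blast
    then show "(Y t i - p t)\<^sup>2 = (1 - 2 * p t) * Y t i + (p t)\<^sup>2"
      by (auto simp: power2_eq_square algebra_simps)
  qed
  also have "\<dots> = (1 - 2 * p t) * (real N * p t) + real N * (p t)\<^sup>2"
    by (simp add: sum.distrib sum_outcomes flip: sum_distrib_left)
  finally show ?thesis by (simp add: power2_eq_square algebra_simps)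
qed

lemma p_bounds: assumes "t \<in> {0, 1}" shows "0 \<le> p t" "p t \<le> 1" "v t \<le> 1" "0 \<le> v t"
proof -
  have b: "0 \<le> Y t i \<and> Y t i \<le> 1" if "i \<in> {1..N}" for i using binary[OF assms that] by auto
  then have "sum (Y t) {1..N} \<le> (\<Sum>i\<in>{1..N}. 1)" by (intro sum_mono) auto
  moreover have "0 \<le> sum (Y t) {1..N}" using b by (intro sum_nonneg) auto
  ultimately show p: "0 \<le> p t" "p t \<le> 1" using sizes by (auto simp: p_of_def)
  show "v t \<le> 1" using p by (intro mult_le_one) auto
  show "0 \<le> v t" using p by simp
qed

lemma S2_eq: "t \<in> {0, 1} \<Longrightarrow> S2 N Y t = real N * v t / (real N - 1)"
  by (simp add: S2_def sum_sq_dev)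

lemma variance_arm_sum:
  assumes "t \<in> {0, 1}"
  shows "srs.E (\<lambda>A. (sum (Y t) A - real N1 * p t)\<^sup>2) = real N1 * real N0 * v t / (real N - 1)"
proof -
  have mean: "sum (Y t) {1..N} / real (card {1..N}) = p t" by (simp add: p_of_def)
  show ?thesis
    using srs.variance_sum[of "Y t"] unfolding mean sum_sq_dev[OF assms]
    using sizes control_pos by (simp add: of_nat_diff)
qed

text \<open>
  The two estimated proportions are close to their targets whenever this quantity is small, so a bound on its mean
  controls every nonlinear error term.
\<close>

definition sq_error :: "(nat \<Rightarrow> real) \<Rightarrow> real" where
  "sq_error W = (p_hat1 N N1 Y W - p 1)\<^sup>2 + (p_hat0 N N1 Y W - p 0)\<^sup>2"

lemma sq_error_nonneg: "0 \<le> sq_error W"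
  by (simp add: sq_error_def)

lemma E_sq_error_le: "E_rand sq_error \<le> 2 / real (min N1 N0)"
proof -
  have "E_rand sq_error = srs.E (\<lambda>A. (sum (Y 1) A - real N1 * p 1)\<^sup>2 / (real N1)\<^sup>2
      + (sum (Y 0) A - real N1 * p 0)\<^sup>2 / (real N0)\<^sup>2)"
    by (rule E_rand_eq) (simp only: sq_error_def p_hat1_eq p_hat0_eq power_divide power2_minus)
  also have "\<dots> = real N1 * real N0 * v 1 / (real N - 1) / (real N1)\<^sup>2
      + real N1 * real N0 * v 0 / (real N - 1) / (real N0)\<^sup>2"
    by (subst Bochner_Integration.integral_add) (simp_all add: variance_arm_sum)
  also have "\<dots> = (real N0 / (real N - 1)) * (v 1 / real N1) + (real N1 / (real N - 1)) * (v 0 / real N0)"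
    using sizes by (simp add: power2_eq_square)
  also have "\<dots> \<le> 1 * (1 / real (min N1 N0)) + 1 * (1 / real (min N1 N0))"
  proof (intro add_mono mult_mono frac_le)
    show "real N0 / (real N - 1) \<le> 1" "real N1 / (real N - 1) \<le> 1"
      using treated_pos control_pos by (simp_all add: divide_le_eq of_nat_diff)
  qed (use sizes p_bounds treated_pos control_pos in auto)
  finally show ?thesis by simp
qed

text \<open>
  The contribution of unit \<open>i\<close> to the linearized error when it is treated. Both potential outcomes enter: treating the
  unit also removes it from the control group.
\<close>

definition influence :: "nat \<Rightarrow> real" where
  "influence i = (Y 1 i - p 1) / (real N1 * v 1) + (Y 0 i - p 0) / (real N0 * v 0)"

definition linear_error :: "(nat \<Rightarrow> real) \<Rightarrow> real" where
  "linear_error W = (p_hat1 N N1 Y W - p 1) / v 1 - (p_hat0 N N1 Y W - p 0) / v 0"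

abbreviation avar :: real where
  "avar \<equiv> avar_log_COR N N1 Y"

lemma sum_influence_sample:
  assumes "A \<in> samples {1..N} N1"
  shows "sum influence A = (sum (Y 1) A - real N1 * p 1) / (real N1 * v 1) + (sum (Y 0) A - real N1 * p 0) / (real N0 * v 0)"
  using assms
  by (simp add: influence_def[abs_def] sum.distrib sum_subtractf samples_def flip: sum_divide_distrib)

lemma linear_error_eq:
  assumes "W \<in> assignments N N1"
  shows "linear_error W = sum influence (treated N W)"
  unfolding linear_error_def sum_influence_sample[OF treated_sample[OF assms]] p_hat1_eq[OF assms] p_hat0_eq[OF assms]
  by (simp only: divide_minus_left diff_minus_eq_add divide_divide_eq_left)

lemma sum_influence: "sum influence {1..N} = 0"
  by (simp add: influence_def[abs_def] sum.distrib sum_subtractf sum_outcomes flip: sum_divide_distrib)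

text \<open>
  The variance of the linear statistic contains the covariance of the two potential outcomes, which is not
  identifiable from the data; \<open>X + Z - 2 * C = (N - 1) * S2_tau\<close> trades it for the variance of the unit effects.
\<close>

lemma E_sum_influence_square:
  assumes v: "v 1 > 0" "v 0 > 0"
  shows "srs.E (\<lambda>A. (sum influence A)\<^sup>2) = avar"
proof -
  define n where "n = real N"
  define a where "a = real N1"
  define b where "b = real N0"
  define v1 where "v1 = v 1"
  define v0 where "v0 = v 0"
  define X where "X = (\<Sum>i=1..N. (Y 1 i - p 1)\<^sup>2)"
  define Z where "Z = (\<Sum>i=1..N. (Y 0 i - p 0)\<^sup>2)"
  define C where "C = (\<Sum>i=1..N. (Y 1 i - p 1) * (Y 0 i - p 0))"
  have pos: "n > 1" "a > 0" "b > 0" "v1 > 0" "v0 > 0" 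
    using sizes v by (auto simp: n_def a_def b_def v1_def v0_def)
  have n: "n = a + b" unfolding n_def a_def b_def by (rule N_split)
  have tau: "tau N Y = p 1 - p 0"
    by (simp add: tau_def tau_unit_def p_of_def sum_subtractf diff_divide_distrib)
  have "(\<Sum>i=1..N. (tau_unit Y i - tau N Y)\<^sup>2) = (\<Sum>i=1..N. (Y 1 i - p 1)\<^sup>2 + (Y 0 i - p 0)\<^sup>2 - 2 * ((Y 1 i - p 1) * (Y 0 i - p 0)))"
    unfolding tau tau_unit_def by (intro sum.cong refl) (simp add: power2_eq_square algebra_simps)
  also have "\<dots> = X + Z - 2 * C"
    by (simp add: X_def Z_def C_def sum.distrib sum_subtractf sum_distrib_left)
  finally have S\<tau>: "S2_tau N Y = (X + Z - 2 * C) / (n - 1)" by (simp add: S2_tau_def n_def)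
  have "(\<Sum>i=1..N. (influence i)\<^sup>2) = (\<Sum>i=1..N. (Y 1 i - p 1)\<^sup>2 / (a * v1)\<^sup>2 + (Y 0 i - p 0)\<^sup>2 / (b * v0)\<^sup>2
      + 2 * ((Y 1 i - p 1) * (Y 0 i - p 0)) / (a * v1 * (b * v0)))"
  proof (intro sum.cong refl)
    have sq: "(x / r + y / s)\<^sup>2 = x\<^sup>2 / r\<^sup>2 + y\<^sup>2 / s\<^sup>2 + 2 * (x * y) / (r * s)" for x y r s :: real
      by (simp add: power2_sum power_divide)
    show "(influence i)\<^sup>2 = (Y 1 i - p 1)\<^sup>2 / (a * v1)\<^sup>2 + (Y 0 i - p 0)\<^sup>2 / (b * v0)\<^sup>2
      + 2 * ((Y 1 i - p 1) * (Y 0 i - p 0)) / (a * v1 * (b * v0))" for i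
      unfolding influence_def a_def b_def v1_def v0_def by (rule sq)
  qed
  also have "\<dots> = X / (a * v1)\<^sup>2 + Z / (b * v0)\<^sup>2 + 2 * C / (a * v1 * (b * v0))"
    by (simp add: X_def Z_def C_def sum.distrib sum_distrib_left flip: sum_divide_distrib)
  finally have I: "(\<Sum>i=1..N. (influence i)\<^sup>2) = X / (a * v1)\<^sup>2 + Z / (b * v0)\<^sup>2 + 2 * C / (a * v1 * (b * v0))" .
  have "srs.E (\<lambda>A. (sum influence A)\<^sup>2) = a * (n - a) / (n * (n - 1)) * (\<Sum>i=1..N. (influence i)\<^sup>2)"
    using srs.E_sum_square[OF sum_influence] unfolding card_atLeastAtMost n_def a_def by simp
  also have "\<dots> = a * b / (n * (n - 1)) * (X / (a * v1)\<^sup>2 + Z / (b * v0)\<^sup>2 + 2 * C / (a * v1 * (b * v0)))"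
    unfolding I n by simp
  also have "\<dots> = (a * v1 + b * v0) / (n * v1 * v0) * (X / (n - 1) / (a * v1) + Z / (n - 1) / (b * v0)
      - (X + Z - 2 * C) / (n - 1) / (a * v1 + b * v0))"
  proof -
    define w where "w = n - 1"
    have nz: "a \<noteq> 0" "b \<noteq> 0" "v1 \<noteq> 0" "v0 \<noteq> 0" "n \<noteq> 0" "w \<noteq> 0" "n * v1 * v0 \<noteq> 0"
        "a * v1 \<noteq> 0" "b * v0 \<noteq> 0" "a * v1 + b * v0 \<noteq> 0"
      using pos add_pos_pos[of "a * v1" "b * v0"] by (auto simp: w_def)
    have "q / d * (X / w / r + Z / w / s - T / w / q) = (q * (X / r + Z / s) - T) / (d * w)"
      if "q \<noteq> 0" "r \<noteq> 0" "s \<noteq> 0" "d \<noteq> 0" for q r s d T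
      using that nz(6) by (simp add: field_simps)
    note this[OF nz(10,8,9,7), of "X + Z - 2 * C"]
    also have "(r + s) * (X / r + Z / s) - (X + Z - 2 * C) = s / r * X + r / s * Z + 2 * C"
      if "r \<noteq> 0" "s \<noteq> 0" for r s
      using that by (simp add: field_simps)
    note this[OF nz(8,9)]
    also have "(b * v0 / (a * v1) * X + a * v1 / (b * v0) * Z + 2 * C) / (n * v1 * v0 * w)
      = a * b / (n * w) * (X / (a * v1)\<^sup>2 + Z / (b * v0)\<^sup>2 + 2 * C / (a * v1 * (b * v0)))"
    proof -
      have "b * v0 / (a * v1) * X / (n * v1 * v0 * w) = a * b / (n * w) * (X / (a * v1)\<^sup>2)"
        and "a * v1 / (b * v0) * Z / (n * v1 * v0 * w) = a * b / (n * w) * (Z / (b * v0)\<^sup>2)"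
        and "2 * C / (n * v1 * v0 * w) = a * b / (n * w) * (2 * C / (a * v1 * (b * v0)))"
        using nz by (simp_all add: power2_eq_square)
      then show ?thesis by (simp only: add_divide_distrib distrib_left)
    qed
    finally show ?thesis unfolding w_def ..
  qed
  also have "\<dots> = avar"
    unfolding avar_log_COR_def Let_def S\<tau> S2_def X_def Z_def n_def a_def b_def v1_def v0_def
    by (simp add: mult.assoc)
  finally show ?thesis .
qed

end

section \<open>Experiments with proportions bounded away from zero and one\<close>

locale overlap_experiment = randomized_experiment +
  fixes \<delta> :: real
  assumes \<delta>_pos: "0 < \<delta>"
    and overlap: "\<And>t. t \<in> {0, 1} \<Longrightarrow> \<delta> \<le> p_of N Y t \<and> p_of N Y t \<le> 1 - \<delta>"
begin

lemma v_ge: "t \<in> {0, 1} \<Longrightarrow> \<delta>\<^sup>2 \<le> v t"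
  unfolding power2_eq_square using overlap[of t] \<delta>_pos by (intro mult_mono) auto

lemma v_pos: "t \<in> {0, 1} \<Longrightarrow> 0 < v t"
  using v_ge[of t] \<delta>_pos by (meson less_le_trans zero_less_power)

lemma \<delta>_le_half: "\<delta> \<le> 1 / 2"
  using overlap[of 1] by simp

abbreviation log_error :: "(nat \<Rightarrow> real) \<Rightarrow> real" where
  "log_error W \<equiv> log_COR_hat N N1 Y W - log_COR N Y"

lemma p_hat_close:
  assumes "0 \<le> s" "sq_error W \<le> s\<^sup>2"
  shows "\<bar>p_hat1 N N1 Y W - p 1\<bar> \<le> s" "\<bar>p_hat0 N N1 Y W - p 0\<bar> \<le> s"
proof -
  have "(p_hat1 N N1 Y W - p 1)\<^sup>2 \<le> s\<^sup>2" "(p_hat0 N N1 Y W - p 0)\<^sup>2 \<le> s\<^sup>2"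
    using assms(2) zero_le_power2[of "p_hat1 N N1 Y W - p 1"] zero_le_power2[of "p_hat0 N N1 Y W - p 0"]
    unfolding sq_error_def by linarith+
  then show "\<bar>p_hat1 N N1 Y W - p 1\<bar> \<le> s" "\<bar>p_hat0 N N1 Y W - p 0\<bar> \<le> s"
    using assms(1) by (simp_all flip: abs_le_square_iff)
qed

lemma log_error_linearization:
  assumes "sq_error W \<le> (\<delta> / 2)\<^sup>2"
  shows "\<bar>log_error W - linear_error W\<bar> \<le> 4 / \<delta>\<^sup>2 * sq_error W"
proof -
  have close: "\<bar>p_hat1 N N1 Y W - p 1\<bar> \<le> \<delta> / 2" "\<bar>p_hat0 N N1 Y W - p 0\<bar> \<le> \<delta> / 2"
    using p_hat_close[OF _ assms] \<delta>_pos by auto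
  have 1: "\<bar>logit (p_hat1 N N1 Y W) - logit (p 1) - (p_hat1 N N1 Y W - p 1) / v 1\<bar>
      \<le> 4 / \<delta>\<^sup>2 * (p_hat1 N N1 Y W - p 1)\<^sup>2"
    using overlap[of 1] \<delta>_pos close by (intro logit_taylor_bound) auto
  have 0: "\<bar>logit (p_hat0 N N1 Y W) - logit (p 0) - (p_hat0 N N1 Y W - p 0) / v 0\<bar>
      \<le> 4 / \<delta>\<^sup>2 * (p_hat0 N N1 Y W - p 0)\<^sup>2"
    using overlap[of 0] \<delta>_pos close by (intro logit_taylor_bound) auto
  have "\<bar>(a - a' - x) - (b - b' - y)\<bar> \<le> r + s \<Longrightarrow> \<bar>((a - b) - (a' - b')) - (x - y)\<bar> \<le> r + s" for a a' b b' x y r s :: real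
    by linarith
  from this[OF order_trans[OF abs_triangle_ineq4 add_mono[OF 1 0]]] show ?thesis
    unfolding log_COR_hat_def log_COR_def linear_error_def sq_error_def distrib_left .
qed

text \<open>
  The linear part is at most \<open>2 * s / \<delta>\<^sup>2\<close>; the quadratic remainder is at most \<open>4 * s\<^sup>2 / \<delta>\<^sup>2\<close>, which adds at
  most one more \<open>s / \<delta>\<^sup>2\<close> because \<open>s \<le> \<delta> / 2 \<le> 1 / 4\<close>.
\<close>

lemma log_error_le:
  assumes s: "0 \<le> s" "s \<le> \<delta> / 2" and W: "sq_error W \<le> s\<^sup>2"
  shows "\<bar>log_error W\<bar> \<le> 3 * s / \<delta>\<^sup>2"
proof -
  have s2: "s\<^sup>2 \<le> (\<delta> / 2)\<^sup>2" using s by (intro power_mono) auto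
  have "\<bar>log_error W - linear_error W\<bar> \<le> 4 / \<delta>\<^sup>2 * sq_error W"
    using W s2 by (intro log_error_linearization) linarith
  also have "\<dots> \<le> 4 / \<delta>\<^sup>2 * s\<^sup>2" using W by (intro mult_left_mono) auto
  also have "\<dots> = (4 * s) * (s / \<delta>\<^sup>2)" by (simp add: power2_eq_square)
  also have "\<dots> \<le> 1 * (s / \<delta>\<^sup>2)" using s \<delta>_le_half by (intro mult_right_mono) auto
  finally have 1: "\<bar>log_error W - linear_error W\<bar> \<le> s / \<delta>\<^sup>2" by simp
  have q: "\<bar>x / v t\<bar> \<le> s / \<delta>\<^sup>2" if "\<bar>x\<bar> \<le> s" "t \<in> {0, 1}" for x t
    using that v_ge[of t] v_pos[of t] \<delta>_pos unfolding abs_divide by (intro frac_le) auto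
  have "\<bar>linear_error W\<bar> \<le> s / \<delta>\<^sup>2 + s / \<delta>\<^sup>2"
    unfolding linear_error_def
    using order_trans[OF abs_triangle_ineq4 add_mono[OF q[of _ 1] q[of _ 0]]] p_hat_close[OF s(1) W] by blast
  with 1 show ?thesis by (simp add: abs_le_iff)
qed

lemma influence_le:
  assumes "i \<in> {1..N}"
  shows "\<bar>influence i\<bar> \<le> 2 / \<delta>\<^sup>2 * (1 / real (min N1 N0))"
proof -
  have q: "\<bar>(Y t i - p t) / (m * v t)\<bar> \<le> 1 / (real (min N1 N0) * \<delta>\<^sup>2)"
    if t: "t \<in> {0, 1}" and m: "real (min N1 N0) \<le> m" for t m
  proof -
    have "Y t i = 0 \<or> Y t i = 1" using binary[OF t assms] by blast
    then have "\<bar>Y t i - p t\<bar> \<le> 1" using p_bounds[OF t] by auto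
    moreover have "real (min N1 N0) * \<delta>\<^sup>2 \<le> m * v t"
      using m v_ge[OF t] by (intro mult_mono) auto
    moreover have "0 < real (min N1 N0) * \<delta>\<^sup>2" using \<delta>_pos treated_pos control_pos by simp
    ultimately show ?thesis unfolding abs_divide by (intro frac_le) auto
  qed
  have "\<bar>influence i\<bar> \<le> 1 / (real (min N1 N0) * \<delta>\<^sup>2) + 1 / (real (min N1 N0) * \<delta>\<^sup>2)"
    unfolding influence_def by (intro order_trans[OF abs_triangle_ineq] add_mono q) auto
  then show ?thesis by simp
qed

lemma char_linear_error_bound:
  assumes avar: "0 < avar"
  defines "u \<equiv> 1 / (real (min N1 N0) * sqrt avar)"
  shows "cmod (E_rand (\<lambda>W. iexp (t * (linear_error W / sqrt avar))) - exp (- t\<^sup>2 / 2))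
    \<le> \<bar>t\<bar> * (t\<^sup>2 * (2 / \<delta>\<^sup>2 * u) + \<bar>t\<bar> * (2 / \<delta>\<^sup>2 * u / 2 + 2 * (1 / real N)))"
proof -
  define c where "c = (\<lambda>i. influence i / sqrt avar)"
  have sum_c: "sum c A = sum influence A / sqrt avar" for A
    by (simp add: c_def sum_divide_distrib)
  have "E_rand (\<lambda>W. iexp (t * (linear_error W / sqrt avar))) = srs.E (\<lambda>A. iexp (t * sum c A))"
    by (rule E_rand_eq) (simp only: linear_error_eq sum_c)
  moreover have "cmod (srs.E (\<lambda>A. iexp (t * sum c A)) - exp (- t\<^sup>2 / 2))
    \<le> \<bar>t\<bar> * (t\<^sup>2 * (2 / \<delta>\<^sup>2 * u) + \<bar>t\<bar> * (2 / \<delta>\<^sup>2 * u / 2 + 2 / real (card {1..N})))"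
  proof (rule srs.char_sample_sum_bound)
    show "sum c {1..N} = 0" unfolding sum_c sum_influence by simp
    have "srs.E (\<lambda>A. (sum c A)\<^sup>2) = srs.E (\<lambda>A. (sum influence A)\<^sup>2 / avar)"
      using avar by (simp add: sum_c power_divide)
    also have "\<dots> = 1" using E_sum_influence_square v_pos avar by simp
    finally show "srs.E (\<lambda>A. (sum c A)\<^sup>2) = 1" .
    show "\<bar>c i\<bar> \<le> 2 / \<delta>\<^sup>2 * u" if "i \<in> {1..N}" for i
    proof -
      have "\<bar>c i\<bar> = \<bar>influence i\<bar> / sqrt avar" using avar by (simp add: c_def abs_divide)
      also have "\<dots> \<le> 2 / \<delta>\<^sup>2 * (1 / real (min N1 N0)) / sqrt avar"
        using influence_le[OF that] avar by (intro divide_right_mono) auto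
      also have "\<dots> = 2 / \<delta>\<^sup>2 * u" by (simp add: u_def del: of_nat_min)
      finally show ?thesis .
    qed
  qed
  ultimately show ?thesis by simp
qed

text \<open>
  Close to the truth the remainder is quadratic. Far from it, where the estimated log odds ratio may even be an
  arbitrary value caused by a zero count, the integrands differ by at most \<open>2\<close>, while the squared error is at
  least \<open>(\<delta> / 2)\<^sup>2\<close>. Either way the difference is bounded by a multiple of the squared error.
\<close>

lemma char_linearization_bound:
  assumes avar: "0 < avar"
  defines "u \<equiv> 1 / (real (min N1 N0) * sqrt avar)"
  shows "cmod (E_rand (\<lambda>W. iexp (t * (log_error W / sqrt avar)))
      - E_rand (\<lambda>W. iexp (t * (linear_error W / sqrt avar))))
    \<le> 8 / \<delta>\<^sup>2 * (\<bar>t\<bar> * u + 2 * (1 / real (min N1 N0)))"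
proof -
  define K where "K = 4 / \<delta>\<^sup>2 * (\<bar>t\<bar> / sqrt avar + 2)"
  have K: "0 \<le> K" using avar by (simp add: K_def)
  have pointwise: "cmod (iexp (t * (log_error W / sqrt avar)) - iexp (t * (linear_error W / sqrt avar)))
      \<le> K * sq_error W" for W
  proof (cases "sq_error W \<le> (\<delta> / 2)\<^sup>2")
    case True
    have "cmod (iexp (t * (log_error W / sqrt avar)) - iexp (t * (linear_error W / sqrt avar)))
      \<le> \<bar>t * (log_error W / sqrt avar) - t * (linear_error W / sqrt avar)\<bar>"
      by (rule cmod_iexp_diff_le)
    also have "\<dots> = \<bar>t\<bar> / sqrt avar * \<bar>log_error W - linear_error W\<bar>"
      using avar by (simp add: abs_mult abs_divide flip: right_diff_distrib diff_divide_distrib)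
    also have "\<dots> \<le> \<bar>t\<bar> / sqrt avar * (4 / \<delta>\<^sup>2 * sq_error W)"
      using log_error_linearization[OF True] avar by (intro mult_left_mono) auto
    also have "\<dots> \<le> K * sq_error W"
      using sq_error_nonneg[of W] by (simp add: K_def algebra_simps)
    finally show ?thesis .
  next
    case False
    have "cmod (iexp (t * (log_error W / sqrt avar)) - iexp (t * (linear_error W / sqrt avar))) \<le> 1 + 1"
      by (intro order_trans[OF norm_triangle_ineq4] add_mono) (simp_all only: norm_exp_i_times order_refl)
    also have "\<dots> \<le> 4 / \<delta>\<^sup>2 * 2 * sq_error W"
    proof -
      have "\<delta>\<^sup>2 \<le> 4 * sq_error W" using False by (simp add: power_divide)
      then show ?thesis using \<delta>_pos by (simp add: field_simps)
    qed
    also have "\<dots> \<le> K * sq_error W"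
      using avar sq_error_nonneg[of W] \<delta>_pos unfolding K_def by (intro mult_right_mono mult_left_mono) auto
    finally show ?thesis .
  qed
  have "cmod (E_rand (\<lambda>W. iexp (t * (log_error W / sqrt avar)))
      - E_rand (\<lambda>W. iexp (t * (linear_error W / sqrt avar))))
    = cmod (E_rand (\<lambda>W. iexp (t * (log_error W / sqrt avar)) - iexp (t * (linear_error W / sqrt avar))))"
    by (simp only: Bochner_Integration.integral_diff[OF integrable_randomization integrable_randomization])
  also have "\<dots> \<le> E_rand (\<lambda>W. cmod (iexp (t * (log_error W / sqrt avar)) - iexp (t * (linear_error W / sqrt avar))))"
    by (rule integral_norm_bound)
  also have "\<dots> \<le> E_rand (\<lambda>W. K * sq_error W)" by (rule E_rand_mono[OF pointwise])
  also have "\<dots> = K * E_rand sq_error" by simp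
  also have "\<dots> \<le> K * (2 / real (min N1 N0))" by (rule mult_left_mono[OF E_sq_error_le K])
  also have "\<dots> = 8 / \<delta>\<^sup>2 * (\<bar>t\<bar> * u + 2 * (1 / real (min N1 N0)))"
  proof -
    have "4 / d * (a / r + 2) * (2 / q) = 8 / d * (a * (1 / (q * r)) + 2 * (1 / q))"
      if "0 < d" "0 < r" "0 < q" for d a r q :: real
      using that by (simp add: field_simps)
    then show ?thesis
      unfolding K_def u_def using \<delta>_pos avar treated_pos control_pos by simp
  qed
  finally show ?thesis .
qed

text \<open>
  Zero variance forces a constant unit effect, which is \<open>- 1\<close>, \<open>0\<close> or \<open>1\<close>; overlap leaves only \<open>0\<close>.
\<close>

lemma no_effect:
  assumes "S2_tau N Y = 0"
  shows "p 1 = p 0"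
proof -
  have "(\<Sum>i=1..N. (tau_unit Y i - tau N Y)\<^sup>2) = 0"
    using assms sizes by (simp add: S2_tau_def)
  then have "(tau_unit Y i - tau N Y)\<^sup>2 = 0" if "i \<in> {1..N}" for i
    using that by (subst (asm) sum_nonneg_eq_0_iff) auto
  from this[of 1] have "tau N Y = Y 1 1 - Y 0 1" using control_pos by (simp add: tau_unit_def)
  moreover have "tau N Y = p 1 - p 0"
    by (simp add: tau_def tau_unit_def p_of_def sum_subtractf diff_divide_distrib)
  ultimately have "p 1 - p 0 = Y 1 1 - Y 0 1" by simp
  moreover have "\<bar>p 1 - p 0\<bar> < 1" using overlap[of 0] overlap[of 1] \<delta>_pos by (simp add: abs_less_iff)
  moreover have "Y 1 1 \<in> {0, 1}" "Y 0 1 \<in> {0, 1}" using binary[of 1 1] binary[of 0 1] control_pos by simp_all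
  ultimately show ?thesis by auto
qed

lemma avar_no_effect:
  assumes "S2_tau N Y = 0"
  shows "avar = real N / (real N - 1) * (1 / real N1 + 1 / real N0) / v 1"
proof -
  have g: "(a * v + b * v) / (n * v * v) * (n * v / (n - 1) / (a * v) + n * v / (n - 1) / (b * v) - 0 / z)
      = n / (n - 1) * (1 / a + 1 / b) / v"
    if "n = a + b" "a > 0" "b > 0" "v > 0" "n > 1" for n a b v z :: real
  proof -
    have "(a * v + b * v) / (n * v * v) = 1 / v" using that by (simp flip: distrib_right)
    moreover have "n * v / (n - 1) / (a * v) = n / (n - 1) * (1 / a)" "n * v / (n - 1) / (b * v) = n / (n - 1) * (1 / b)"
      using that by simp_all
    ultimately show ?thesis by (simp only: distrib_left) simp
  qed
  show ?thesis
    using g[OF N_split sizes(1,2) v_pos[of 1] sizes(3)] assms no_effect[OF assms]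
    by (simp add: avar_log_COR_def Let_def S2_eq mult.assoc)
qed

lemma V_hat_eq:
  assumes W: "W \<in> assignments N N1"
    and P: "0 < p_hat1 N N1 Y W" "p_hat1 N N1 Y W < 1" "0 < p_hat0 N N1 Y W" "p_hat0 N N1 Y W < 1"
  shows "V_hat_COR N Y W = 1 / (real N1 * (p_hat1 N N1 Y W * (1 - p_hat1 N N1 Y W)))
    + 1 / (real N0 * (p_hat0 N N1 Y W * (1 - p_hat0 N N1 Y W)))"
proof -
  have n: "real (n_obs N Y W 1 1) = real N1 * p_hat1 N N1 Y W"
    "real (n_obs N Y W 1 0) = real N1 * (1 - p_hat1 N N1 Y W)"
    "real (n_obs N Y W 0 1) = real N0 * p_hat0 N N1 Y W"
    "real (n_obs N Y W 0 0) = real N0 * (1 - p_hat0 N N1 Y W)"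
    using sizes unfolding p_hat1_def p_hat0_def observed_counts[OF W] by (simp_all add: right_diff_distrib)
  have g: "1 / (m * q) + 1 / (m * (1 - q)) = 1 / (m * (q * (1 - q)))" if "0 < m" "0 < q" "q < 1" for m q :: real
    using that by (simp add: field_simps)
  show ?thesis
    unfolding V_hat_COR_def n g[OF sizes(1) P(1,2), symmetric] g[OF sizes(2) P(3,4), symmetric]
    by (simp only: add.assoc)
qed

text \<open>
  With \<open>p 1 = p 0 = q\<close>, the ratio is \<open>(N - 1) / N\<close> times a weighted average, with weights \<open>N0 / N\<close> and
  \<open>N1 / N\<close>, of the ratios of \<open>q * (1 - q)\<close> to its two estimates. Each of these ratios is \<open>1\<close> up to \<open>4 * s / \<delta>\<^sup>2\<close>, and the
  factor \<open>(N - 1) / N\<close> adds the bias \<open>1 / N\<close>.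
\<close>

lemma V_hat_ratio_close:
  assumes S: "S2_tau N Y = 0" and W: "W \<in> assignments N N1"
    and s: "0 \<le> s" "s \<le> \<delta> / 2" and close: "sq_error W \<le> s\<^sup>2"
  shows "\<bar>V_hat_COR N Y W / avar - 1\<bar> \<le> 4 * s / \<delta>\<^sup>2 + 1 / real N"
proof -
  define P1 where "P1 = p_hat1 N N1 Y W"
  define P0 where "P0 = p_hat0 N N1 Y W"
  define q where "q = p 1"
  define e where "e = (\<lambda>P. q * (1 - q) / (P * (1 - P)) - 1)"
  have q: "\<delta> \<le> q" "q \<le> 1 - \<delta>" using overlap[of 1] by (auto simp: q_def)
  have P: "\<bar>P1 - q\<bar> \<le> s" "\<bar>P0 - q\<bar> \<le> s"
    using p_hat_close[OF s(1) close] no_effect[OF S] by (auto simp: P1_def P0_def q_def)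
  have inner: "\<delta> / 2 \<le> P" "\<delta> / 2 \<le> 1 - P" if "\<bar>P - q\<bar> \<le> s" for P
    using that s q by (auto simp: abs_le_iff)
  have e: "\<bar>e P\<bar> \<le> 4 * s / \<delta>\<^sup>2" if P: "\<bar>P - q\<bar> \<le> s" for P
  proof -
    have w: "\<delta> / 2 * (\<delta> / 2) \<le> P * (1 - P)" using inner[OF P] \<delta>_pos by (intro mult_mono) auto
    moreover have d: "0 < \<delta> / 2 * (\<delta> / 2)" using \<delta>_pos by simp
    ultimately have "P * (1 - P) \<noteq> 0" by linarith
    then have "e P = (q * (1 - q) - P * (1 - P)) / (P * (1 - P))"
      unfolding e_def diff_divide_distrib by (subst divide_self) auto
    also have "q * (1 - q) - P * (1 - P) = (P - q) * (P + q - 1)" by (simp add: algebra_simps)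
    finally have "e P = (P - q) * (P + q - 1) / (P * (1 - P))" .
    moreover have "\<bar>P + q - 1\<bar> \<le> 1" using q inner[OF P] \<delta>_pos by (auto simp: abs_le_iff)
    then have "\<bar>(P - q) * (P + q - 1)\<bar> \<le> s * 1"
      unfolding abs_mult using P by (intro mult_mono) auto
    ultimately have "\<bar>e P\<bar> \<le> s * 1 / (\<delta> / 2 * (\<delta> / 2))"
      using w d by (simp only: abs_divide) (intro frac_le, auto)
    then show ?thesis by (simp add: power2_eq_square mult.commute)
  qed
  have g: "(1 / (a * w1) + 1 / (b * w0)) / (n / (n - 1) * (1 / a + 1 / b) / z) - 1
      = (n - 1) / n * ((z / w1 - 1) * (b / n) + (z / w0 - 1) * (a / n)) - 1 / n"
    if "n = a + b" "a > 0" "b > 0" "n > 1" "z > 0" "w1 > 0" "w0 > 0" for n a b z w1 w0 :: real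
  proof -
    have h: "1 / a + 1 / b = n / (a * b)" using that by (simp add: field_simps)
    have "(1 / (a * w1) + 1 / (b * w0)) / (n / (n - 1) * (1 / a + 1 / b) / z)
      = (n - 1) / n * (z / w1 * (b / n) + z / w0 * (a / n))"
      unfolding h using that(2-) by (simp add: field_simps)
    moreover have "b / n + a / n = 1" using that(1,4) by (simp flip: add_divide_distrib)
    then have "(z / w1 - 1) * (b / n) + (z / w0 - 1) * (a / n) = z / w1 * (b / n) + z / w0 * (a / n) - 1"
      unfolding left_diff_distrib mult_1_left by linarith
    ultimately show ?thesis using that(4) by (simp add: right_diff_distrib diff_divide_distrib)
  qed
  have pos: "0 < P1" "P1 < 1" "0 < P0" "P0 < 1" using inner[OF P(1)] inner[OF P(2)] \<delta>_pos by auto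
  have "V_hat_COR N Y W / avar - 1 = (real N - 1) / real N * (e P1 * (real N0 / real N) + e P0 * (real N1 / real N)) - 1 / real N"
    unfolding avar_no_effect[OF S] V_hat_eq[OF W pos[unfolded P1_def P0_def]] P1_def[symmetric] P0_def[symmetric]
      q_def[symmetric] e_def
    using pos q \<delta>_pos sizes by (intro g[OF N_split]) auto
  also have "\<bar>\<dots>\<bar> \<le> 1 * (4 * s / \<delta>\<^sup>2 * (real N0 / real N) + 4 * s / \<delta>\<^sup>2 * (real N1 / real N)) + 1 / real N"
  proof (intro order_trans[OF abs_triangle_ineq4] add_mono)
    have "\<bar>e P1 * (real N0 / real N) + e P0 * (real N1 / real N)\<bar>
      \<le> 4 * s / \<delta>\<^sup>2 * (real N0 / real N) + 4 * s / \<delta>\<^sup>2 * (real N1 / real N)"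
      by (intro order_trans[OF abs_triangle_ineq] add_mono)
         (simp_all only: abs_mult abs_of_nonneg[OF divide_nonneg_nonneg[OF of_nat_0_le_iff of_nat_0_le_iff]],
          intro mult_right_mono e P divide_nonneg_nonneg of_nat_0_le_iff, intro mult_right_mono e P divide_nonneg_nonneg of_nat_0_le_iff)
    moreover have "\<bar>(real N - 1) / real N\<bar> \<le> 1" using sizes(3) by simp
    ultimately show "\<bar>(real N - 1) / real N * (e P1 * (real N0 / real N) + e P0 * (real N1 / real N))\<bar>
      \<le> 1 * (4 * s / \<delta>\<^sup>2 * (real N0 / real N) + 4 * s / \<delta>\<^sup>2 * (real N1 / real N))"
      unfolding abs_mult[of "(real N - 1) / real N"] by (intro mult_mono) auto
  qed auto
  also have "\<dots> = 4 * s / \<delta>\<^sup>2 * ((real N0 + real N1) / real N) + 1 / real N"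
    by (simp only: add_divide_distrib distrib_left mult_1)
  also have "real N0 + real N1 = real N" unfolding N_split by (rule add.commute)
  also have "real N / real N = 1" using sizes(3) by simp
  finally show ?thesis by simp
qed

end

section \<open>Asymptotics of the log odds ratio\<close>

theorem theorem4:
  fixes N N1 :: "nat \<Rightarrow> nat"
    and Y :: "nat \<Rightarrow> nat \<Rightarrow> nat \<Rightarrow> real"
    and \<delta> :: real
  assumes binary: "\<And>k t i. t \<in> {0, 1} \<Longrightarrow> i \<in> {1..N k} \<Longrightarrow> Y k t i \<in> {0, 1}"
    and arms: "\<And>k. 0 < N1 k \<and> N1 k < N k"
    and N_lim: "filterlim N at_top sequentially"
    and N1_lim: "filterlim N1 at_top sequentially"
    and N0_lim: "filterlim (\<lambda>k. N k - N1 k) at_top sequentially"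
    and p_interior: "\<And>k t. t \<in> {0, 1} \<Longrightarrow> 0 < p_of (N k) (Y k) t \<and> p_of (N k) (Y k) t < 1"
    and p_bounded: "0 < \<delta>"
      "\<And>k t. t \<in> {0, 1} \<Longrightarrow> \<delta> \<le> p_of (N k) (Y k) t \<and> p_of (N k) (Y k) t \<le> 1 - \<delta>"
  shows
    "tendsto_in_prob (\<lambda>k. randomization (N k) (N1 k))
       (\<lambda>k W. log_COR_hat (N k) (N1 k) (Y k) W - log_COR (N k) (Y k)) 0
     \<and>
     (filterlim (\<lambda>k. (real (min (N1 k) (N k - N1 k)))\<^sup>2 * avar_log_COR (N k) (N1 k) (Y k))
        at_top sequentially \<longrightarrow>
      weak_conv_m
        (\<lambda>k. distr (randomization (N k) (N1 k)) borel
           (\<lambda>W. (log_COR_hat (N k) (N1 k) (Y k) W - log_COR (N k) (Y k))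
                / sqrt (avar_log_COR (N k) (N1 k) (Y k))))
        std_normal_distribution)
     \<and>
     ((\<forall>k. S2_tau (N k) (Y k) = 0) \<longrightarrow>
      tendsto_in_prob (\<lambda>k. randomization (N k) (N1 k))
        (\<lambda>k W. V_hat_COR (N k) (Y k) W / avar_log_COR (N k) (N1 k) (Y k)) 1)"
proof -
  define m where "m = (\<lambda>k. min (N1 k) (N k - N1 k))"
  define avar where "avar = (\<lambda>k. avar_log_COR (N k) (N1 k) (Y k))"
  have exp: "overlap_experiment (N k) (N1 k) (Y k) \<delta>" for k
    by unfold_locales (use binary arms p_bounded in auto)
  have re: "randomized_experiment (N k) (N1 k) (Y k)" for k
    using exp[of k] by (simp add: overlap_experiment_def)
  define D where "D = (\<lambda>k. randomized_experiment.sq_error (N k) (N1 k) (Y k))"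
  have m_lim: "filterlim (\<lambda>k. real (m k)) at_top sequentially"
  proof -
    have "\<forall>\<^sub>F k in sequentially. Z \<le> m k" for Z
      using filterlim_at_top[THEN iffD1, OF N1_lim, rule_format, of Z]
        filterlim_at_top[THEN iffD1, OF N0_lim, rule_format, of Z]
      by eventually_elim (simp add: m_def)
    then have "filterlim m at_top sequentially" by (simp add: filterlim_at_top)
    then show ?thesis by (rule filterlim_compose[OF filterlim_real_sequentially])
  qed
  have inv_m: "(\<lambda>k. 1 / real (m k)) \<longlonglongrightarrow> 0"
    by (intro tendsto_divide_0[OF tendsto_const] filterlim_at_top_imp_at_infinity m_lim)
  have inv_N: "(\<lambda>k. 1 / real (N k)) \<longlonglongrightarrow> 0"
    by (intro tendsto_divide_0[OF tendsto_const] filterlim_at_top_imp_at_infinity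
        filterlim_compose[OF filterlim_real_sequentially N_lim])
  have fin: "finite (set_pmf (randomization (N k) (N1 k)))" for k
    using randomized_experiment.set_randomization[OF re] randomized_experiment.finite_assignments[OF re] by simp
  have D_nonneg: "0 \<le> D k W" for k W
    unfolding D_def by (rule randomized_experiment.sq_error_nonneg[OF re])
  have D_lim: "(\<lambda>k. measure_pmf.expectation (randomization (N k) (N1 k)) (D k)) \<longlonglongrightarrow> 0"
  proof (rule tendsto_sandwich[OF _ _ tendsto_const])
    show "\<forall>\<^sub>F k in sequentially. 0 \<le> measure_pmf.expectation (randomization (N k) (N1 k)) (D k)"
      by (intro always_eventually allI integral_nonneg_AE) (simp add: D_nonneg)
    show "\<forall>\<^sub>F k in sequentially. measure_pmf.expectation (randomization (N k) (N1 k)) (D k) \<le> 2 * (1 / real (m k))"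
      using randomized_experiment.E_sq_error_le[OF re] by (intro always_eventually allI) (simp add: D_def m_def)
    show "(\<lambda>k. 2 * (1 / real (m k))) \<longlonglongrightarrow> 0" using tendsto_mult_right_zero[OF inv_m] .
  qed
  have radius: "\<exists>s>0. s \<le> \<delta> / 2 \<and> C * s / \<delta>\<^sup>2 \<le> \<epsilon>" if "0 < \<epsilon>" "0 < C" for \<epsilon> C :: real
  proof (intro exI conjI)
    let ?s = "min (\<delta> / 2) (\<epsilon> * \<delta>\<^sup>2 / C)"
    show "0 < ?s" using that p_bounded(1) by simp
    have "C * ?s \<le> C * (\<epsilon> * \<delta>\<^sup>2 / C)" using that by (intro mult_left_mono) auto
    then show "C * ?s / \<delta>\<^sup>2 \<le> \<epsilon>" using that p_bounded(1) by (simp add: divide_le_eq)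
    show "?s \<le> \<delta> / 2" by (rule min.cobounded1)
  qed
  have consistency: "tendsto_in_prob (\<lambda>k. randomization (N k) (N1 k))
       (\<lambda>k W. log_COR_hat (N k) (N1 k) (Y k) W - log_COR (N k) (Y k)) 0"
  proof (rule tendsto_in_prob_if_controlled[OF fin D_nonneg D_lim])
    fix \<epsilon> :: real assume "0 < \<epsilon>"
    then obtain s where s: "0 < s" "s \<le> \<delta> / 2" "3 * s / \<delta>\<^sup>2 \<le> \<epsilon>" using radius[of \<epsilon> 3] by auto
    have "\<bar>log_COR_hat (N k) (N1 k) (Y k) W - log_COR (N k) (Y k) - 0\<bar> \<le> \<epsilon>" if "D k W \<le> s\<^sup>2" for k W
      using overlap_experiment.log_error_le[OF exp, of s k W] that s by (simp add: D_def)
    then show "\<exists>\<eta>>0. \<forall>\<^sub>F k in sequentially. \<forall>W\<in>set_pmf (randomization (N k) (N1 k)). D k W \<le> \<eta> \<longrightarrow>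
        \<bar>log_COR_hat (N k) (N1 k) (Y k) W - log_COR (N k) (Y k) - 0\<bar> \<le> \<epsilon>"
      using s(1) by (intro exI[of _ "s\<^sup>2"]) auto
  qed
  have normality: "weak_conv_m
        (\<lambda>k. distr (randomization (N k) (N1 k)) borel
           (\<lambda>W. (log_COR_hat (N k) (N1 k) (Y k) W - log_COR (N k) (Y k)) / sqrt (avar k)))
        std_normal_distribution"
    if lim: "filterlim (\<lambda>k. (real (m k))\<^sup>2 * avar k) at_top sequentially"
  proof (rule levy_continuity)
    let ?X = "\<lambda>k W. (log_COR_hat (N k) (N1 k) (Y k) W - log_COR (N k) (Y k)) / sqrt (avar k)"
    show "real_distribution (distr (randomization (N k) (N1 k)) borel (?X k))" for k
      by (rule prob_space.real_distribution_distr[OF measure_pmf.prob_space_axioms]) simp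
    show "real_distribution std_normal_distribution" by (rule real_dist_normal_dist)
    define u where "u = (\<lambda>k. 1 / (real (m k) * sqrt (avar k)))"
    \<comment> \<open>The square root of the growth condition: the reciprocal of \<open>u\<close> diverges.\<close>
    have "filterlim (\<lambda>k. real (m k) * sqrt (avar k)) at_top sequentially"
      using filterlim_compose[OF sqrt_at_top lim] by (simp add: real_sqrt_mult)
    then have u_lim: "u \<longlonglongrightarrow> 0"
      unfolding u_def by (intro tendsto_divide_0[OF tendsto_const] filterlim_at_top_imp_at_infinity)
    have avar_pos: "\<forall>\<^sub>F k in sequentially. 0 < avar k"
      using filterlim_at_top_dense[THEN iffD1, OF lim, rule_format, of 0]
      by eventually_elim (simp add: zero_less_mult_iff)
    fix t :: real
    define B where "B = (\<lambda>k. 8 / \<delta>\<^sup>2 * (\<bar>t\<bar> * u k + 2 * (1 / real (m k)))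
      + \<bar>t\<bar> * (t\<^sup>2 * (2 / \<delta>\<^sup>2 * u k) + \<bar>t\<bar> * (2 / \<delta>\<^sup>2 * u k / 2 + 2 * (1 / real (N k)))))"
    have "(\<lambda>k. 8 / \<delta>\<^sup>2 * (\<bar>t\<bar> * x k + 2 * y k) + \<bar>t\<bar> * (t\<^sup>2 * (2 / \<delta>\<^sup>2 * x k) + \<bar>t\<bar> * (2 / \<delta>\<^sup>2 * x k / 2 + 2 * z k)))
      \<longlonglongrightarrow> 8 / \<delta>\<^sup>2 * (\<bar>t\<bar> * 0 + 2 * 0) + \<bar>t\<bar> * (t\<^sup>2 * (2 / \<delta>\<^sup>2 * 0) + \<bar>t\<bar> * (2 / \<delta>\<^sup>2 * 0 / 2 + 2 * 0))"
      if "x \<longlonglongrightarrow> 0" "y \<longlonglongrightarrow> 0" "z \<longlonglongrightarrow> 0" for x y z :: "nat \<Rightarrow> real"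
      by (intro tendsto_intros that; simp)
    from this[OF u_lim inv_m inv_N] have B_lim: "B \<longlonglongrightarrow> 0"
      unfolding B_def by simp
    have char: "char (distr (randomization (N k) (N1 k)) borel (?X k)) t
      = measure_pmf.expectation (randomization (N k) (N1 k)) (\<lambda>W. iexp (t * ?X k W))" for k
      unfolding char_def by (rule integral_distr) auto
    have "\<forall>\<^sub>F k in sequentially.
      cmod (char (distr (randomization (N k) (N1 k)) borel (?X k)) t - exp (- t\<^sup>2 / 2)) \<le> B k"
      using avar_pos
    proof eventually_elim
      case (elim k)
      interpret overlap_experiment "N k" "N1 k" "Y k" \<delta> by (rule exp)
      have pos: "0 < avar_log_COR (N k) (N1 k) (Y k)" using elim by (simp add: avar_def)
      show ?case
        unfolding char unfolding B_def u_def m_def avar_def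
        using norm_triangle_le[OF add_mono[OF char_linearization_bound[OF pos, of t] char_linear_error_bound[OF pos, of t]]]
        by (simp only: diff_add_cancel diff_add_eq add_diff_eq)
    qed
    then have "(\<lambda>k. char (distr (randomization (N k) (N1 k)) borel (?X k)) t - exp (- t\<^sup>2 / 2)) \<longlonglongrightarrow> 0"
      by (rule Lim_null_comparison[OF _ B_lim])
    then show "(\<lambda>k. char (distr (randomization (N k) (N1 k)) borel (?X k)) t) \<longlonglongrightarrow> char std_normal_distribution t"
      unfolding char_std_normal_distribution by (rule LIM_zero_cancel)
  qed
  have variance: "tendsto_in_prob (\<lambda>k. randomization (N k) (N1 k))
        (\<lambda>k W. V_hat_COR (N k) (Y k) W / avar k) 1"
    if S: "\<forall>k. S2_tau (N k) (Y k) = 0"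
  proof (rule tendsto_in_prob_if_controlled[OF fin D_nonneg D_lim])
    fix \<epsilon> :: real assume \<epsilon>: "0 < \<epsilon>"
    then obtain s where s: "0 < s" "s \<le> \<delta> / 2" "4 * s / \<delta>\<^sup>2 \<le> \<epsilon> / 2" using radius[of "\<epsilon> / 2" 4] by auto
    have "\<forall>\<^sub>F k in sequentially. 1 / real (N k) < \<epsilon> / 2"
      using order_tendstoD(2)[OF inv_N, of "\<epsilon> / 2"] \<epsilon> by simp
    then have "\<forall>\<^sub>F k in sequentially. \<forall>W\<in>set_pmf (randomization (N k) (N1 k)). D k W \<le> s\<^sup>2 \<longrightarrow>
        \<bar>V_hat_COR (N k) (Y k) W / avar k - 1\<bar> \<le> \<epsilon>"
    proof eventually_elim
      case (elim k)
      interpret overlap_experiment "N k" "N1 k" "Y k" \<delta> by (rule exp)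
      show ?case
        using V_hat_ratio_close[OF S[rule_format] _ _ s(2)] s elim
        by (fastforce simp: set_randomization D_def avar_def)
    qed
    then show "\<exists>\<eta>>0. \<forall>\<^sub>F k in sequentially. \<forall>W\<in>set_pmf (randomization (N k) (N1 k)). D k W \<le> \<eta> \<longrightarrow>
        \<bar>V_hat_COR (N k) (Y k) W / avar k - 1\<bar> \<le> \<epsilon>"
      using s(1) by (intro exI[of _ "s\<^sup>2"]) auto
  qed
  show ?thesis
    using consistency normality variance unfolding m_def avar_def by blast
qed

end
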